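(* In the coloured tree model described in the context, suppose that the following conditions hold for all $i,j\in\{1,\dots,d\}$: (i) $[0,1]\subseteq\mathbb{D}$ and $0\in\mathrm{Int}(\mathbb{D})$; (ii) $\mathbb{E}|\log\tilde\xi_{ij}|<\infty$ and $\mathbb{E}|\tilde\xi_{ij}\log\tilde\xi_{ij}|<\infty$; (iii) the function $s\mapsto\mathbb{E}[\tilde\xi_{ij}^{\,s}]$ belongs to $C^2(\mathbb{R}_+)$. Suppose moreover that $\lambda:=\inf_{s\ge 0}\rho(s)<1$ and $\mu:=-\Lambda'(0)>0$ (equivalently, $\rho'(0)<0$). Then $$\lim_{t\to\infty}\frac{\log\mathbb{E}[Z(e^{-t})]}{t}=\min\{s\in\mathbb{D}:\rho(s)=1\}.$$
   Context: Let $d\ge 2$ and let $T_d$ be the $d$-ary regular rooted tree with vertex set $\mathbb{V}$ and root $u_0$ (every vertex has exactly $d$ children). For $u\in\mathbb{V}$, $\ell(u)$ is the unique self-avoiding path from the root to $u$, $|u|$ is its number of edges, and $\mathbb{V}_n=\{u:|u|=n\}$. Colouring: the root is given an arbitrary colour in $\{1,\dots,d\}$. Recursively in the levels, and independently for each vertex, the $d$ children of each vertex are coloured with $d$ distinct colours, all $d!$ possibilities being equally likely. The colour of $u$ is $c(u)$. Labels: $\tilde\xi_{ij}$, $i,j\in\{1,\dots,d\}$, are $d^2$ strictly positive, non-degenerate random variables with a given joint distribution. Given the colouring, each edge $(u,w)$ with $u$ the parent of $w$ carries a random variable $\zeta_{uw}$ distributed as $\tilde\xi_{c(u)c(w)}$.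 For any edges $(u_1,w_1),\dots,(u_m,w_m)$ with $u_i$ the parent of $w_i$ and the parents $u_i$ pairwise distinct, the labels $\zeta_{u_1w_1},\dots,\zeta_{u_mw_m}$ are independent. $\mathbb{P}$ and $\mathbb{E}$ refer to the joint law of the colouring and the labels. The value $\zeta[u]$ of a vertex $u$ is the product of the labels on the edges of $\ell(u)$ (equal to $1$ for the root), and for $x>0$, $Z(x)=\mathrm{card}\{u\in\mathbb{V}:\zeta[u]\ge x\}$. $\mathbb{D}=\{s\in\mathbb{R}:\mathbb{E}[\tilde\xi_{ij}^{\,s}]<\infty\ \forall i,j\}$ and $\mathrm{Int}(\mathbb{D})$ is its interior. $m(s)$ is the $d\times d$ matrix with entries $\mathbb{E}[\tilde\xi_{ij}^{\,s}]$ ($s\in\mathbb{D}$), and $\rho(s)>0$ is its largest (Perron–Frobenius) eigenvalue. $\Lambda(s)=\log\rho(s)-\log d$. *)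

theory Defs
  imports "HOL-Probability.Probability"
begin

text \<open>The colours are the elements of a finite type \<open>'d\<close>, so that \<open>d = CARD('d)\<close>.  The vertices of
  the \<open>d\<close>-ary tree are the words over \<open>'d\<close>: the root is \<open>[]\<close> and the children of \<open>u\<close> are the words
  \<open>u @ [k]\<close>.  The letters are only addresses; the (random) colour of a vertex is unrelated to them.
  An edge is identified with its lower endpoint \<open>w \<noteq> []\<close>; its upper endpoint is \<open>butlast w\<close>.\<close>

definition colour_algebra :: "'a measure \<Rightarrow> ('d::finite list \<Rightarrow> 'a \<Rightarrow> 'd) \<Rightarrow> 'a measure" where
  "colour_algebra M c =
     vimage_algebra (space M) (\<lambda>\<omega> u. c u \<omega>) (Pi\<^sub>M UNIV (\<lambda>_. count_space UNIV))"

text \<open>\<open>\<xi> i j\<close> are the random variables on \<open>N\<close> with the prescribed laws, \<open>r\<close> is the colour of the root,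
  \<open>c u\<close> the colour of the vertex \<open>u\<close>, and \<open>\<zeta> w\<close> the label of the edge into \<open>w\<close>
  (the value \<open>\<zeta> []\<close> is never used).\<close>

locale coloured_tree = N: prob_space N + M: prob_space M
  for N :: "'b measure" and \<xi> :: "'d::finite \<Rightarrow> 'd \<Rightarrow> 'b \<Rightarrow> real"
    and M :: "'a measure" and r :: 'd
    and c :: "'d list \<Rightarrow> 'a \<Rightarrow> 'd" and \<zeta> :: "'d list \<Rightarrow> 'a \<Rightarrow> real" +
  assumes measurable_xi: "\<And>i j. \<xi> i j \<in> borel_measurable N"
    and xi_positive: "\<And>i j. AE x in N. 0 < \<xi> i j x"
    and xi_nondegenerate: "\<And>i j. \<not> (\<exists>a. AE x in N. \<xi> i j x = a)"
    and measurable_colour: "\<And>u. c u \<in> measurable M (count_space UNIV)"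
    and measurable_label: "\<And>w. \<zeta> w \<in> borel_measurable M"
    and root_colour: "AE \<omega> in M. c [] \<omega> = r"
    \<comment> \<open>The map \<open>k \<mapsto> c (u @ [k])\<close> is a uniformly random bijection, independently for each vertex \<open>u\<close>.\<close>
    and children_uniform:
      "\<And>u. distr M (count_space UNIV) (\<lambda>\<omega> k. c (u @ [k]) \<omega>)
         = measure_pmf (pmf_of_set {p. bij p})"
    and children_indep:
      "M.indep_vars (\<lambda>_. count_space UNIV) (\<lambda>u \<omega> k. c (u @ [k]) \<omega>) UNIV"
    \<comment> \<open>Conditionally on the colouring, each label has the law of the corresponding \<open>\<xi> i j\<close>
      (take \<open>E\<close> a singleton), and labels of edges with pairwise distinct parents are independent.
      Nothing is required of the joint law of labels of edges with a common parent.\<close>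
    and labels_given_colours:
      "\<And>E B. finite E \<Longrightarrow> [] \<notin> E \<Longrightarrow> inj_on butlast E \<Longrightarrow> (\<And>w. w \<in> E \<Longrightarrow> B w \<in> sets borel) \<Longrightarrow>
         AE \<omega> in M.
           real_cond_exp M (colour_algebra M c)
             (indicator {\<omega> \<in> space M. \<forall>w\<in>E. \<zeta> w \<omega> \<in> B w}) \<omega>
           = (\<Prod>w\<in>E. measure (distr N borel (\<xi> (c (butlast w) \<omega>) (c w \<omega>))) (B w))"

definition vertex_value :: "('d list \<Rightarrow> 'a \<Rightarrow> real) \<Rightarrow> 'd list \<Rightarrow> 'a \<Rightarrow> real" where
  "vertex_value \<zeta> u \<omega> = (\<Prod>k\<in>{1..length u}. \<zeta> (take k u) \<omega>)"

text \<open>The counting measure is used because the set may be infinite.\<close>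

definition vertex_count :: "('d list \<Rightarrow> 'a \<Rightarrow> real) \<Rightarrow> real \<Rightarrow> 'a \<Rightarrow> ennreal" where
  "vertex_count \<zeta> x \<omega> = emeasure (count_space UNIV) {u. x \<le> vertex_value \<zeta> u \<omega>}"

definition expected_count :: "'a measure \<Rightarrow> ('d list \<Rightarrow> 'a \<Rightarrow> real) \<Rightarrow> real \<Rightarrow> ennreal" where
  "expected_count M \<zeta> x = (\<integral>\<^sup>+\<omega>. vertex_count \<zeta> x \<omega> \<partial>M)"

definition moment_domain :: "'b measure \<Rightarrow> ('d::finite \<Rightarrow> 'd \<Rightarrow> 'b \<Rightarrow> real) \<Rightarrow> real set" where
  "moment_domain N \<xi> = {s. \<forall>i j. integrable N (\<lambda>x. \<xi> i j x powr s)}"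

text \<open>The following quantities are meaningful only for \<open>s \<in> moment_domain N \<xi>\<close>.\<close>

definition moment_matrix :: "'b measure \<Rightarrow> ('d::finite \<Rightarrow> 'd \<Rightarrow> 'b \<Rightarrow> real) \<Rightarrow> real \<Rightarrow> real^'d^'d" where
  "moment_matrix N \<xi> s = (\<chi> i j. integral\<^sup>L N (\<lambda>x. \<xi> i j x powr s))"

definition largest_eigenvalue :: "real^'d^'d \<Rightarrow> real" where
  "largest_eigenvalue A = (GREATEST r. \<exists>v. v \<noteq> 0 \<and> A *v v = r *\<^sub>R v)"

definition perron_root :: "'b measure \<Rightarrow> ('d::finite \<Rightarrow> 'd \<Rightarrow> 'b \<Rightarrow> real) \<Rightarrow> real \<Rightarrow> real" where
  "perron_root N \<xi> s = largest_eigenvalue (moment_matrix N \<xi> s)"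

definition log_perron :: "'b measure \<Rightarrow> ('d::finite \<Rightarrow> 'd \<Rightarrow> 'b \<Rightarrow> real) \<Rightarrow> real \<Rightarrow> real" where
  "log_perron N \<xi> s = ln (perron_root N \<xi> s) - ln (real CARD('d))"

definition C2_on :: "real set \<Rightarrow> (real \<Rightarrow> real) \<Rightarrow> bool" where
  "C2_on S f \<longleftrightarrow> (\<exists>f' f''.
     (\<forall>s\<in>S. (f has_real_derivative f' s) (at s within S)) \<and>
     (\<forall>s\<in>S. (f' has_real_derivative f'' s) (at s within S)) \<and>
     continuous_on S f'')"

end

theory Submission
  imports Defs "HOL-Real_Asymp.Real_Asymp"
begin

text \<open>
  Along the path to a vertex the colours form a uniform i.i.d. sequence, and given the colours the
  labels on the path are independent.  Summing over the \<open>d ^ n\<close> vertices of level \<open>n\<close> cancels the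
  factor \<open>d ^ - n\<close> of a colour sequence, so one more level acts on functions of the pair (colour, value)
  as a positive operator whose action on \<open>y powr s\<close> is multiplication by the matrix \<open>m s\<close>
  (\<open>markov_step_parent\<close>, \<open>level_expectation_Suc\<close>).  Hence the sum over level \<open>n\<close> of the expected
  \<open>s\<close>-th powers of the values has order \<open>\<rho> s ^ n\<close> (\<open>level_moment_eigenvector\<close>).

  The Perron root is log-convex in \<open>s\<close>, it equals \<open>d > 1\<close> at \<open>0\<close>, and it is below \<open>1\<close> somewhere on
  the half-line.  So it has a least root \<open>\<alpha>\<close> of \<open>\<rho> s = 1\<close>, with \<open>\<alpha> > 0\<close>, and \<open>\<rho> < 1\<close> immediately
  to the right of \<open>\<alpha>\<close> (\<open>critical_exponent\<close>).

  Upper bound: if \<open>\<rho> s < 1\<close>, Markov's inequality with exponent \<open>s\<close> and a geometric series over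
  the levels give \<open>E Z(x) \<le> C x powr - s\<close> (\<open>expected_count_upper\<close>); let \<open>s\<close> decrease to \<open>\<alpha>\<close>.

  Lower bound: fix \<open>\<beta> < \<alpha>\<close>.  If for all \<open>n\<close> and \<open>T > 0\<close> the expected number of vertices of level
  \<open>n\<close> with the colour of the root and a value of at least \<open>exp (- T)\<close> were at most \<open>exp (\<beta> * T)\<close>,
  then the \<open>\<alpha>\<close>-th moment of level \<open>n\<close> would tend to \<open>0\<close>: values above \<open>exp (- \<delta> * n)\<close> contribute
  little by comparison with an exponent \<open>s > \<alpha>\<close> where \<open>\<rho> s < 1\<close>, and smaller values contribute a
  geometric tail.  This contradicts \<open>\<rho> \<alpha> = 1\<close>.  So some pair \<open>n, T\<close> violates the bound
  (\<open>exists_large_level_tail\<close>), and the tails are supermultiplicative (a path from the root colour to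
  itself can be repeated), which propagates this single violation to all multiples of \<open>T\<close> and,
  by monotonicity, to all \<open>t\<close> (\<open>expected_count_lower\<close>).
\<close>

section \<open>The Perron root of a positive matrix\<close>

text \<open>Compare \<open>y\<close> with \<open>w\<close> at an index where the ratio \<open>\<bar>y$i\<bar> / w$i\<close> is maximal.  This one inequality
  serves both to show that a positive eigenvector belongs to the largest eigenvalue and to bound the
  largest eigenvalue by means of any positive supersolution.\<close>

lemma collatz_wielandt_bound:
  fixes A :: "real^'d^'d"
  assumes nonneg: "\<And>i j. 0 \<le> A$i$j" and w: "\<And>i. 0 < w$i"
    and super: "\<And>i. (A *v w)$i \<le> K * w$i"
    and "y \<noteq> 0" and sub: "\<And>i. R * \<bar>y$i\<bar> \<le> (\<Sum>j\<in>UNIV. A$i$j * \<bar>y$j\<bar>)"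
  shows "R \<le> K"
proof -
  define t where "t = Max (range (\<lambda>i. \<bar>y$i\<bar> / w$i))"
  have "t \<in> range (\<lambda>i. \<bar>y$i\<bar> / w$i)"
    unfolding t_def by (rule Max_in) auto
  then obtain p where p: "t = \<bar>y$p\<bar> / w$p" by auto
  have le: "\<bar>y$j\<bar> \<le> t * w$j" for j
  proof -
    have "\<bar>y$j\<bar> / w$j \<le> t" unfolding t_def by (rule Max_ge) auto
    with w[of j] show ?thesis by (simp add: divide_le_eq)
  qed
  obtain q where "y$q \<noteq> 0" using \<open>y \<noteq> 0\<close> by (auto simp: vec_eq_iff)
  then have "0 < t * w$q" using le[of q] by simp
  then have t: "0 < t" using w[of q] by (simp add: zero_less_mult_iff)
  have "R * (t * w$p) = R * \<bar>y$p\<bar>" using p w[of p] by simp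
  also have "\<dots> \<le> (\<Sum>j\<in>UNIV. A$p$j * \<bar>y$j\<bar>)" by (rule sub)
  also have "\<dots> \<le> (\<Sum>j\<in>UNIV. A$p$j * (t * w$j))"
    by (intro sum_mono mult_left_mono le nonneg)
  also have "\<dots> = t * (A *v w)$p"
    by (simp add: matrix_vector_mult_def sum_distrib_left algebra_simps)
  also have "\<dots> \<le> t * (K * w$p)" using super t by simp
  finally have "R * (t * w$p) \<le> K * (t * w$p)" by (simp add: algebra_simps)
  moreover have "0 < t * w$p" using t w[of p] by simp
  ultimately show ?thesis by (meson mult_le_cancel_right_pos)
qed

lemma largest_eigenvalue_eqI:
  fixes A :: "real^'d^'d"
  assumes nonneg: "\<And>i j. 0 \<le> A$i$j" and v: "\<And>i. 0 < v$i" and eig: "A *v v = \<rho> *\<^sub>R v"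
  shows "largest_eigenvalue A = \<rho>"
  unfolding largest_eigenvalue_def
proof (rule Greatest_equality)
  have "v \<noteq> 0" using v by (metis less_irrefl zero_index)
  then show "\<exists>v. v \<noteq> 0 \<and> A *v v = \<rho> *\<^sub>R v" using eig by blast
next
  fix R assume "\<exists>y. y \<noteq> 0 \<and> A *v y = R *\<^sub>R y"
  then obtain y where y: "y \<noteq> 0" "A *v y = R *\<^sub>R y" by blast
  have "R * \<bar>y$i\<bar> \<le> (\<Sum>j\<in>UNIV. A$i$j * \<bar>y$j\<bar>)" for i
  proof -
    have "R * \<bar>y$i\<bar> \<le> \<bar>(A *v y)$i\<bar>" using y(2) by (simp add: abs_mult mult_right_mono)
    also have "\<dots> \<le> (\<Sum>j\<in>UNIV. A$i$j * \<bar>y$j\<bar>)"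
      unfolding matrix_vector_mult_def using nonneg
      by (auto intro!: order_trans[OF sum_abs] sum_mono simp: abs_mult)
    finally show ?thesis .
  qed
  then show "R \<le> \<rho>" using collatz_wielandt_bound[OF nonneg v _ y(1), of \<rho>] eig by simp
qed

text \<open>Perron's theorem, from Brouwer's theorem for the map \<open>x \<mapsto> A x\<close>, normalised to
  total mass \<open>1\<close>, on the simplex: a fixed point is an eigenvector, and it is positive because
  \<open>A x\<close> is positive for every \<open>x\<close> in the simplex.\<close>

lemma perron_eigenvector:
  fixes A :: "real^'d^'d"
  assumes pos: "\<And>i j. 0 < A$i$j"
  obtains v where "\<And>i. 0 < v$i" "A *v v = largest_eigenvalue A *\<^sub>R v" "0 < largest_eigenvalue A"
proof -
  define S where "S = {x::real^'d. (\<forall>i. 0 \<le> x$i) \<and> (\<Sum>i\<in>UNIV. x$i) = 1}"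
  define \<sigma> where "\<sigma> = (\<lambda>x. \<Sum>i\<in>UNIV. (A *v x)$i)"
  have "closed S"
    unfolding S_def
    by (intro closed_Collect_conj closed_Collect_all closed_Collect_le closed_Collect_eq continuous_intros)
  moreover have "bounded S"
  proof (rule boundedI)
    fix x assume x: "x \<in> S"
    have "norm x \<le> (\<Sum>i\<in>UNIV. \<bar>x$i\<bar>)" by (rule norm_le_l1_cart)
    also have "\<dots> = 1" using x by (simp add: S_def)
    finally show "norm x \<le> 1" .
  qed
  ultimately have "compact S" by (simp add: compact_eq_bounded_closed)
  have "convex S"
    by (auto simp: S_def convex_def sum.distrib simp flip: sum_distrib_left)
  have "(\<chi> i. 1 / real CARD('d)) \<in> S" by (simp add: S_def)
  then have "S \<noteq> {}" by blast
  have Apos: "0 < (A *v x)$i" if x: "x \<in> S" for x i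
  proof -
    obtain k where "x$k \<noteq> 0" using x by (force simp: S_def)
    then have "0 < x$k" using x by (auto simp: S_def order_less_le)
    then show ?thesis using x pos
      unfolding matrix_vector_mult_def S_def
      by (auto intro!: sum_pos2[of _ k] mult_nonneg_nonneg simp: less_imp_le)
  qed
  have \<sigma>: "0 < \<sigma> x" if "x \<in> S" for x
    unfolding \<sigma>_def using Apos[OF that] by (simp add: sum_pos)
  have cont: "continuous_on S (\<lambda>x. (1 / \<sigma> x) *\<^sub>R (A *v x))"
    using \<sigma> unfolding \<sigma>_def
    by (intro continuous_intros matrix_vector_mult_linear_continuous_on) (auto dest!: \<sigma>[unfolded \<sigma>_def])
  have into: "(\<lambda>x. (1 / \<sigma> x) *\<^sub>R (A *v x)) \<in> S \<rightarrow> S"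
  proof
    fix x assume x: "x \<in> S"
    have "(\<Sum>i\<in>UNIV. ((1 / \<sigma> x) *\<^sub>R (A *v x))$i) = 1"
      using \<sigma>[OF x] by (simp add: \<sigma>_def flip: sum_divide_distrib)
    then show "(1 / \<sigma> x) *\<^sub>R (A *v x) \<in> S"
      using Apos[OF x] \<sigma>[OF x] by (auto simp: S_def less_imp_le)
  qed
  obtain v where v: "v \<in> S" "(1 / \<sigma> v) *\<^sub>R (A *v v) = v"
    using brouwer[OF \<open>compact S\<close> \<open>convex S\<close> \<open>S \<noteq> {}\<close> cont into] by blast
  have pos_v: "0 < v$i" for i
    using Apos[OF v(1), of i] \<sigma>[OF v(1)] arg_cong[OF v(2), of "\<lambda>x. x$i"]
    by (metis divide_pos_pos divide_real_def mult_1 real_scaleR_def times_divide_eq_left vector_scaleR_component)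
  have eig: "A *v v = \<sigma> v *\<^sub>R v"
    using v(2) \<sigma>[OF v(1)] by (metis divide_self_if less_irrefl scaleR_one scaleR_scaleR times_divide_eq_right mult.right_neutral)
  have "largest_eigenvalue A = \<sigma> v"
    using largest_eigenvalue_eqI[OF less_imp_le[OF pos] pos_v eig] .
  then show thesis using that[OF pos_v] eig \<sigma>[OF v(1)] by metis
qed

lemma largest_eigenvalue_le:
  fixes A :: "real^'d^'d"
  assumes pos: "\<And>i j. 0 < A$i$j" and w: "\<And>i. 0 < w$i" and super: "\<And>i. (A *v w)$i \<le> K * w$i"
  shows "largest_eigenvalue A \<le> K"
proof -
  obtain v where v: "\<And>i. 0 < v$i" "A *v v = largest_eigenvalue A *\<^sub>R v"
    using perron_eigenvector[OF pos] by metis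
  have "v \<noteq> 0" using v(1) by (metis less_irrefl zero_index)
  moreover have "largest_eigenvalue A * \<bar>v$i\<bar> \<le> (\<Sum>j\<in>UNIV. A$i$j * \<bar>v$j\<bar>)" for i
    using arg_cong[OF v(2), of "\<lambda>x. x$i"] v(1)
    by (simp add: matrix_vector_mult_def abs_of_pos)
  ultimately show ?thesis
    using collatz_wielandt_bound[OF less_imp_le[OF pos] w super] by blast
qed

section \<open>Log-convexity of the Perron root\<close>

context coloured_tree begin

lemma moment_matrix_nth: "moment_matrix N \<xi> s $ i $ j = (\<integral>x. \<xi> i j x powr s \<partial>N)"
  by (simp add: moment_matrix_def)

lemma moment_integrable: "s \<in> moment_domain N \<xi> \<Longrightarrow> integrable N (\<lambda>x. \<xi> i j x powr s)"
  by (simp add: moment_domain_def)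

lemma moment_pos:
  assumes "s \<in> moment_domain N \<xi>"
  shows "0 < moment_matrix N \<xi> s $ i $ j"
proof -
  have "\<not> (AE x in N. \<xi> i j x powr s = 0)"
  proof
    assume "AE x in N. \<xi> i j x powr s = 0"
    with xi_positive[of i j] have "AE x in N. False" by eventually_elim simp
    then show False by simp
  qed
  then have "(\<integral>x. \<xi> i j x powr s \<partial>N) \<noteq> 0"
    using integral_nonneg_eq_0_iff_AE[OF moment_integrable[OF assms], of i j] by simp
  moreover have "0 \<le> (\<integral>x. \<xi> i j x powr s \<partial>N)" by simp
  ultimately show ?thesis unfolding moment_matrix_nth by linarith
qed

lemma perron_pair:
  assumes "s \<in> moment_domain N \<xi>"
  obtains v where "\<And>i. 0 < v i"
    "\<And>i. (\<Sum>j\<in>UNIV. moment_matrix N \<xi> s $ i $ j * v j) = perron_root N \<xi> s * v i"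
proof -
  obtain v where v: "\<And>i. 0 < v$i"
      "moment_matrix N \<xi> s *v v = largest_eigenvalue (moment_matrix N \<xi> s) *\<^sub>R v"
    using perron_eigenvector[OF moment_pos[OF assms]] by metis
  have "(\<Sum>j\<in>UNIV. moment_matrix N \<xi> s $ i $ j * v$j) = perron_root N \<xi> s * v$i" for i
    using arg_cong[OF v(2), of "\<lambda>x. x$i"] by (simp add: matrix_vector_mult_def perron_root_def)
  with v(1) show thesis by (rule that)
qed

lemma perron_root_pos: "s \<in> moment_domain N \<xi> \<Longrightarrow> 0 < perron_root N \<xi> s"
  unfolding perron_root_def by (rule perron_eigenvector[OF moment_pos])

lemma perron_root_0: "perron_root N \<xi> 0 = real CARD('d)"
proof -
  have one: "moment_matrix N \<xi> 0 $ i $ j = 1" for i j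
  proof -
    have "(\<integral>x. \<xi> i j x powr 0 \<partial>N) = (\<integral>x. 1 \<partial>N)"
    proof (rule integral_cong_AE)
      show "AE x in N. \<xi> i j x powr 0 = 1" using xi_positive[of i j] by eventually_elim simp
    qed (use measurable_xi in measurable)
    then show ?thesis by (simp add: moment_matrix_nth N.prob_space)
  qed
  show ?thesis
    unfolding perron_root_def
    by (rule largest_eigenvalue_eqI[where v = "\<chi> i. 1"])
       (auto simp: one matrix_vector_mult_def vec_eq_iff)
qed

text \<open>Kingman's theorem.  If \<open>u\<close> and \<open>v\<close> are Perron eigenvectors at \<open>a\<close> and \<open>b\<close>, the weighted geometric
  mean \<open>w i = u i powr (1 - \<theta>) * v i powr \<theta>\<close> is a supersolution for the claimed bound at the intermediate
  exponent.  Both applications of Hoelder's inequality (to the expectation and to the sum over \<open>j\<close>)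
  are replaced by one pointwise weighted inequality of arithmetic and geometric means, applied to
  terms that are normalised so that their expectations sum to \<open>1\<close>.\<close>

lemma perron_root_log_convex:
  assumes a: "a \<in> moment_domain N \<xi>" and b: "b \<in> moment_domain N \<xi>"
    and \<theta>: "0 \<le> \<theta>" "\<theta> \<le> 1" and dom: "(1-\<theta>) * a + \<theta> * b \<in> moment_domain N \<xi>"
  shows "perron_root N \<xi> ((1-\<theta>) * a + \<theta> * b) \<le> perron_root N \<xi> a powr (1-\<theta>) * perron_root N \<xi> b powr \<theta>"
proof -
  let ?s = "(1-\<theta>) * a + \<theta> * b"
  define Ra Rb where "Ra = perron_root N \<xi> a" and "Rb = perron_root N \<xi> b"
  have R: "0 < Ra" "0 < Rb" using perron_root_pos a b by (auto simp: Ra_def Rb_def)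
  obtain u where u: "\<And>i. 0 < u i" "\<And>i. (\<Sum>j\<in>UNIV. moment_matrix N \<xi> a $ i $ j * u j) = Ra * u i"
    unfolding Ra_def by (rule perron_pair[OF a]) metis
  obtain v where v: "\<And>i. 0 < v i" "\<And>i. (\<Sum>j\<in>UNIV. moment_matrix N \<xi> b $ i $ j * v j) = Rb * v i"
    unfolding Rb_def by (rule perron_pair[OF b]) metis
  define K where "K = Ra powr (1-\<theta>) * Rb powr \<theta>"
  have K: "0 < K" using R by (simp add: K_def)
  define w where "w i = u i powr (1-\<theta>) * v i powr \<theta>" for i
  have w: "0 < w i" for i using u(1)[of i] v(1)[of i] by (simp add: w_def)
  have entry: "moment_matrix N \<xi> ?s $ i $ j * w j / (K * w i)
      \<le> (1-\<theta>) * (moment_matrix N \<xi> a $ i $ j * u j / (Ra * u i))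
        + \<theta> * (moment_matrix N \<xi> b $ i $ j * v j / (Rb * v i))" for i j
  proof -
    let ?X = "\<xi> i j"
    have "(\<integral>x. ?X x powr ?s * (w j / (K * w i)) \<partial>N)
      \<le> (\<integral>x. (1-\<theta>) * (u j / (Ra * u i)) * ?X x powr a + \<theta> * (v j / (Rb * v i)) * ?X x powr b \<partial>N)"
    proof (rule integral_mono_AE)
      show "integrable N (\<lambda>x. ?X x powr ?s * (w j / (K * w i)))"
        using moment_integrable[OF dom] by simp
      show "integrable N (\<lambda>x. (1-\<theta>) * (u j / (Ra * u i)) * ?X x powr a
                               + \<theta> * (v j / (Rb * v i)) * ?X x powr b)"
        using moment_integrable[OF a] moment_integrable[OF b] by simp
      show "AE x in N. ?X x powr ?s * (w j / (K * w i))
         \<le> (1-\<theta>) * (u j / (Ra * u i)) * ?X x powr a + \<theta> * (v j / (Rb * v i)) * ?X x powr b"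
        using xi_positive[of i j]
      proof eventually_elim
        case (elim x)
        let ?p = "?X x powr a * (u j / (Ra * u i))" and ?q = "?X x powr b * (v j / (Rb * v i))"
        have "?X x powr ?s = (?X x powr a) powr (1-\<theta>) * (?X x powr b) powr \<theta>"
          using elim by (simp add: powr_powr powr_add mult.commute)
        then have "?X x powr ?s * (w j / (K * w i)) = ?p powr (1-\<theta>) * ?q powr \<theta>"
          using R u(1) v(1) by (simp add: w_def K_def powr_mult powr_divide mult_ac)
        also have "\<dots> \<le> (1-\<theta>) * ?p + \<theta> * ?q"
          using elim R u(1) v(1) \<theta> by (intro Youngs_inequality_0) auto
        finally show ?case by (simp add: algebra_simps)
      qed
    qed
    then show ?thesis
      using moment_integrable[OF a, of i j] moment_integrable[OF b, of i j]
      by (simp add: moment_matrix_nth algebra_simps)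
  qed
  have "(moment_matrix N \<xi> ?s *v (\<chi> i. w i)) $ i \<le> K * (\<chi> i. w i) $ i" for i
  proof -
    have "(\<Sum>j\<in>UNIV. moment_matrix N \<xi> ?s $ i $ j * w j) / (K * w i)
        = (\<Sum>j\<in>UNIV. moment_matrix N \<xi> ?s $ i $ j * w j / (K * w i))"
      by (simp add: sum_divide_distrib)
    also have "\<dots> \<le> (\<Sum>j\<in>UNIV. (1-\<theta>) * (moment_matrix N \<xi> a $ i $ j * u j / (Ra * u i))
        + \<theta> * (moment_matrix N \<xi> b $ i $ j * v j / (Rb * v i)))"
      by (intro sum_mono entry)
    also have "\<dots> = (1-\<theta>) * ((\<Sum>j\<in>UNIV. moment_matrix N \<xi> a $ i $ j * u j) / (Ra * u i))
        + \<theta> * ((\<Sum>j\<in>UNIV. moment_matrix N \<xi> b $ i $ j * v j) / (Rb * v i))"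
      by (simp add: sum.distrib sum_distrib_left sum_divide_distrib)
    also have "\<dots> = 1"
      using R u(1)[of i] v(1)[of i] by (simp add: u(2) v(2))
    finally show ?thesis
      using K w[of i] by (simp add: divide_le_eq matrix_vector_mult_def)
  qed
  then show ?thesis
    unfolding perron_root_def[of _ _ ?s] K_def[unfolded Ra_def Rb_def, symmetric]
    using w by (intro largest_eigenvalue_le[OF moment_pos[OF dom], of "\<chi> i. w i"]) auto
qed

end

section \<open>The Markov step along an edge\<close>

text \<open>By symmetry: composing with a transposition of colours exchanges the bijections that take
  the value \<open>j\<close> at \<open>l\<close> with those that take the value \<open>j'\<close> there.\<close>

lemma prob_bij_value:
  fixes l j :: "'d::finite"
  shows "measure (measure_pmf (pmf_of_set {p::'d\<Rightarrow>'d. bij p})) {p. p l = j} = 1 / real CARD('d)"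
proof -
  let ?S = "{p::'d\<Rightarrow>'d. bij p}" and ?B = "\<lambda>j. {p::'d\<Rightarrow>'d. bij p \<and> p l = j}"
  have "id \<in> ?S" by simp
  then have ne: "?S \<noteq> {}" by blast
  have same: "card (?B j') = card (?B j)" for j'
  proof (rule bij_betw_same_card)
    show "bij_betw (\<lambda>p. Transposition.transpose j j' \<circ> p) (?B j') (?B j)"
      by (rule bij_betw_byWitness[where f' = "\<lambda>p. Transposition.transpose j j' \<circ> p"])
         (auto simp: bij_comp comp_assoc[symmetric])
  qed
  have "card ?S = card (\<Union>j'. ?B j')" by (rule arg_cong[where f = card]) auto
  also have "\<dots> = (\<Sum>j'\<in>UNIV. card (?B j'))"
    by (rule card_UN_disjoint) auto
  also have "\<dots> = CARD('d) * card (?B j)" by (subst same) simp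
  finally have card: "card ?S = CARD('d) * card (?B j)" .
  moreover have "card ?S \<noteq> 0" using ne by simp
  ultimately have "card (?B j) \<noteq> 0" by auto
  have "measure (measure_pmf (pmf_of_set ?S)) {p. p l = j} = real (card (?B j)) / real (card ?S)"
    using ne by (subst measure_pmf_of_set) (auto simp: Int_def)
  with card \<open>card (?B j) \<noteq> 0\<close> show ?thesis by simp
qed

context coloured_tree begin

lemmas [measurable] = measurable_xi measurable_colour measurable_label

lemma subalgebra_colour: "subalgebra M (colour_algebra M c)"
proof -
  have "(\<lambda>\<omega> u. c u \<omega>) \<in> measurable M (Pi\<^sub>M UNIV (\<lambda>_. count_space UNIV))"
    by (rule measurable_PiM_single') auto
  then show ?thesis
    unfolding subalgebra_def colour_algebra_def by (auto dest: sets_image_in_sets[OF refl])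
qed

sublocale colours: finite_measure_subalgebra M "colour_algebra M c"
  by unfold_locales (rule subalgebra_colour)

lemma measurable_colour_algebra: "c u \<in> measurable (colour_algebra M c) (count_space UNIV)"
proof -
  have "(\<lambda>\<omega> u. c u \<omega>) \<in> measurable (colour_algebra M c) (Pi\<^sub>M UNIV (\<lambda>_. count_space UNIV))"
    unfolding colour_algebra_def by (rule measurable_vimage_algebra1) (auto simp: space_PiM)
  from measurable_compose[OF this measurable_component_singleton[of u]] show ?thesis by simp
qed

lemma measurable_vertex_value [measurable]: "vertex_value \<zeta> u \<in> borel_measurable M"
  unfolding vertex_value_def by measurable

text \<open>The defining property of the conditional expectation, in product form, for the edges of the
  path to \<open>u\<close>.  The parents of these edges are distinct, being prefixes of \<open>u\<close> of different lengths.\<close>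

lemma label_box_given_colours:
  assumes D: "D \<in> sets (colour_algebra M c)" and B: "\<And>i. B i \<in> sets borel"
  shows "measure M {\<omega>\<in>D. \<forall>i\<in>{1..length u}. \<zeta> (take i u) \<omega> \<in> B i}
    = (\<integral>\<omega>. indicator D \<omega> *
        (\<Prod>i\<in>{1..length u}. measure (distr N borel (\<xi> (c (take (i-1) u) \<omega>) (c (take i u) \<omega>))) (B i)) \<partial>M)"
proof -
  let ?E = "(\<lambda>i. take i u) ` {1..length u}" and ?Bw = "\<lambda>w. B (length w)"
  let ?V = "{\<omega> \<in> space M. \<forall>w\<in>?E. \<zeta> w \<omega> \<in> ?Bw w}"
  have DM: "D \<in> sets M" using D subalgebra_colour by (auto simp: subalgebra_def)
  have V: "?V \<in> sets M" using B by measurable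
  have inj: "inj_on (\<lambda>i. take i u) {1..length u}"
    by (rule inj_on_inverseI[where g = length]) auto
  have "inj_on butlast ?E"
  proof (rule inj_onI)
    fix v w assume "v \<in> ?E" "w \<in> ?E" and eq: "butlast v = butlast w"
    then obtain i k where ik: "i \<in> {1..length u}" "v = take i u" "k \<in> {1..length u}" "w = take k u"
      by blast
    with arg_cong[OF eq, of length] have "i = k" by (auto simp: min_def split: if_splits)
    with ik show "v = w" by simp
  qed
  then have ce: "AE \<omega> in M. real_cond_exp M (colour_algebra M c) (indicator ?V) \<omega>
     = (\<Prod>w\<in>?E. measure (distr N borel (\<xi> (c (butlast w) \<omega>) (c w \<omega>))) (?Bw w))"
    by (intro labels_given_colours) (auto simp: B)
  have prod: "(\<Prod>w\<in>?E. measure (distr N borel (\<xi> (c (butlast w) \<omega>) (c w \<omega>))) (?Bw w))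
    = (\<Prod>i\<in>{1..length u}. measure (distr N borel (\<xi> (c (take (i-1) u) \<omega>) (c (take i u) \<omega>))) (B i))" for \<omega>
    by (subst prod.reindex[OF inj]) (auto intro!: prod.cong simp: butlast_take min_def)
  have [measurable]: "D \<in> sets M" "?V \<in> sets M" using DM V by auto
  have DV: "D \<inter> ?V \<in> sets M" using DM V by (rule sets.Int)
  have "{\<omega>\<in>D. \<forall>i\<in>{1..length u}. \<zeta> (take i u) \<omega> \<in> B i} = D \<inter> ?V"
    using sets.sets_into_space[OF DM] by (auto simp: min_def)
  then have "measure M {\<omega>\<in>D. \<forall>i\<in>{1..length u}. \<zeta> (take i u) \<omega> \<in> B i} = measure M (D \<inter> ?V)" by simp
  also have "\<dots> = (\<integral>\<omega>. indicator (D \<inter> ?V) \<omega> \<partial>M)"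
    by (subst Bochner_Integration.integral_indicator) (simp only: sets.Int_space_eq2[OF DV])
  also have "\<dots> = (\<integral>\<omega>\<in>D. indicator ?V \<omega> \<partial>M)"
    by (simp add: set_lebesgue_integral_def indicator_inter_arith)
  also have "\<dots> = (\<integral>\<omega>\<in>D. real_cond_exp M (colour_algebra M c) (indicator ?V) \<omega> \<partial>M)"
    by (rule colours.real_cond_exp_intA[OF _ D])
       (use V in \<open>auto intro!: integrable_real_indicator simp: M.emeasure_eq_measure\<close>)
  also have "\<dots> = (\<integral>\<omega>. indicator D \<omega> *
     (\<Prod>i\<in>{1..length u}. measure (distr N borel (\<xi> (c (take (i-1) u) \<omega>) (c (take i u) \<omega>))) (B i)) \<partial>M)"
    unfolding set_lebesgue_integral_def
  proof (rule integral_cong_AE)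
    show "AE \<omega> in M. indicat_real D \<omega> *\<^sub>R real_cond_exp M (colour_algebra M c) (indicator ?V) \<omega> =
      indicat_real D \<omega> *
     (\<Prod>i\<in>{1..length u}. measure (distr N borel (\<xi> (c (take (i-1) u) \<omega>) (c (take i u) \<omega>))) (B i))"
      using ce unfolding prod by eventually_elim simp
    show "(\<lambda>\<omega>. indicat_real D \<omega> *\<^sub>R real_cond_exp M (colour_algebra M c) (indicator ?V) \<omega>) \<in> borel_measurable M"
      by measurable
    have "(\<lambda>\<omega>. case (c v \<omega>, c w \<omega>) of (a, b) \<Rightarrow> measure (distr N borel (\<xi> a b)) (B i)) \<in> borel_measurable M" for v w i
      unfolding prod.case
      by (intro measurable_compose_countable[OF _ measurable_colour, of "\<lambda>a \<omega>. measure (distr N borel (\<xi> a (c w \<omega>))) (B i)"]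
                measurable_compose_countable[OF _ measurable_colour, of "\<lambda>b \<omega>. measure (distr N borel (\<xi> _ b)) (B i)"]) simp
    then show "(\<lambda>\<omega>. indicat_real D \<omega> *
     (\<Prod>i\<in>{1..length u}. measure (distr N borel (\<xi> (c (take (i-1) u) \<omega>) (c (take i u) \<omega>))) (B i))) \<in> borel_measurable M"
      by (intro borel_measurable_times borel_measurable_prod) simp_all
  qed
  finally show ?thesis .
qed

text \<open>The colours on the path to \<open>u\<close> are determined by the root colour and by the child colourings at the
  proper prefixes of \<open>u\<close>, whereas the colour of \<open>u @ [l]\<close> is determined by the child colouring at \<open>u\<close>
  itself.  These families of child colourings are independent.\<close>

lemma next_colour_independent:
  fixes g :: "('d list \<Rightarrow> 'd) \<Rightarrow> real"
  assumes g: "\<And>\<kappa> \<kappa>'. (\<And>i. i \<le> length u \<Longrightarrow> \<kappa> (take i u) = \<kappa>' (take i u)) \<Longrightarrow> g \<kappa> = g \<kappa>'"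
  shows "(\<integral>\<omega>. g (\<lambda>w. c w \<omega>) * indicator {\<omega>. c (u @ [l]) \<omega> = j} \<omega> \<partial>M)
       = (\<integral>\<omega>. g (\<lambda>w. c w \<omega>) \<partial>M) / real CARD('d)"
proof -
  define P where "P = (\<lambda>i. take i u) ` {..<length u}"
  define C where "C v \<omega> k = c (v @ [k]) \<omega>" for v \<omega> k
  define col where "col \<phi> w = (if w = [] then r else \<phi> (butlast w) (last w))"
    for \<phi> :: "'d list \<Rightarrow> 'd \<Rightarrow> 'd" and w
  have fin: "finite P" by (simp add: P_def)
  have "length v < length u" if "v \<in> P" for v using that by (auto simp: P_def)
  then have notin: "u \<notin> P" by blast
  have cnt: "PiM P (\<lambda>_. count_space UNIV) = count_space (PiE P (\<lambda>_. UNIV::('d \<Rightarrow> 'd) set))"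
    using fin by (intro count_space_PiM_finite) auto
  have col_g: "AE \<omega> in M. g (\<lambda>w. c w \<omega>) = g (col (restrict (\<lambda>v. C v \<omega>) P))"
    using root_colour
  proof eventually_elim
    case (elim \<omega>)
    show ?case
    proof (rule g)
      fix i assume i: "i \<le> length u"
      show "c (take i u) \<omega> = col (restrict (\<lambda>v. C v \<omega>) P) (take i u)"
      proof (cases "take i u = []")
        case True then show ?thesis using elim by (auto simp: col_def)
      next
        case False
        then have "butlast (take i u) = take (i-1) u" "i - 1 < length u"
          using i by (auto simp: butlast_take)
        then have "butlast (take i u) \<in> P" by (auto simp: P_def)
        then show ?thesis using False by (simp add: col_def C_def)
      qed
    qed
  qed
  have "M.indep_var (PiM P (\<lambda>_. count_space UNIV)) (\<lambda>\<omega>. restrict (\<lambda>v. C v \<omega>) P)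
                    (PiM {u} (\<lambda>_. count_space UNIV)) (\<lambda>\<omega>. restrict (\<lambda>v. C v \<omega>) {u})"
    using children_indep notin unfolding C_def by (intro M.indep_var_restrict) auto
  then have "M.indep_var borel ((\<lambda>\<phi>. g (col \<phi>)) \<circ> (\<lambda>\<omega>. restrict (\<lambda>v. C v \<omega>) P))
                 borel ((\<lambda>\<phi>. indicat_real {p. p l = j} (\<phi> u)) \<circ> (\<lambda>\<omega>. restrict (\<lambda>v. C v \<omega>) {u}))"
  proof (rule M.indep_var_compose)
    show "(\<lambda>\<phi>. g (col \<phi>)) \<in> borel_measurable (PiM P (\<lambda>_. count_space UNIV))"
      unfolding cnt by simp
    show "(\<lambda>\<phi>. indicat_real {p. p l = j} (\<phi> u)) \<in> borel_measurable (PiM {u} (\<lambda>_. count_space UNIV))"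
      by (rule measurable_compose[OF measurable_component_singleton]) auto
  qed
  then have ind: "M.indep_var borel (\<lambda>\<omega>. g (col (restrict (\<lambda>v. C v \<omega>) P)))
                 borel (\<lambda>\<omega>. indicat_real {p. p l = j} (C u \<omega>))"
    by (simp add: comp_def)
  have [measurable]: "(\<lambda>\<omega>. g (col (restrict (\<lambda>v. C v \<omega>) P))) \<in> borel_measurable M"
    using M.indep_var_rv1[OF ind] .
  have [measurable]: "(\<lambda>\<omega>. indicat_real {p. p l = j} (C u \<omega>)) \<in> borel_measurable M"
    using M.indep_var_rv2[OF ind] .
  have "range (\<lambda>\<omega>. restrict (\<lambda>v. C v \<omega>) P) \<subseteq> PiE P (\<lambda>_. UNIV)" by auto
  then have "finite (range (\<lambda>\<omega>. restrict (\<lambda>v. C v \<omega>) P))"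
    by (rule finite_subset) (simp add: finite_PiE fin)
  then have "finite ((\<lambda>\<phi>. g (col \<phi>)) ` range (\<lambda>\<omega>. restrict (\<lambda>v. C v \<omega>) P))"
    by (rule finite_imageI)
  then have "bounded ((\<lambda>\<phi>. g (col \<phi>)) ` range (\<lambda>\<omega>. restrict (\<lambda>v. C v \<omega>) P))"
    by (rule finite_imp_bounded)
  then obtain b where "\<And>\<omega>. \<bar>g (col (restrict (\<lambda>v. C v \<omega>) P))\<bar> \<le> b"
    by (auto simp: bounded_iff)
  then have int1: "integrable M (\<lambda>\<omega>. g (col (restrict (\<lambda>v. C v \<omega>) P)))"
    by (intro M.integrable_const_bound[where B = b]) auto
  have int2: "integrable M (\<lambda>\<omega>. indicat_real {p. p l = j} (C u \<omega>))"
    by (intro M.integrable_const_bound[where B = 1]) auto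
  have child: "C u \<in> measurable M (count_space UNIV)"
    using children_indep by (auto simp: M.indep_vars_def C_def[abs_def])
  have "(\<integral>\<omega>. indicat_real {p. p l = j} (C u \<omega>) \<partial>M)
      = (\<integral>p. indicat_real {p. p l = j} p \<partial>distr M (count_space UNIV) (C u))"
    using child by (subst integral_distr) auto
  also have "\<dots> = measure (measure_pmf (pmf_of_set {p. bij p})) {p. p l = j}"
    using children_uniform[of u] by (simp add: C_def[abs_def])
  finally have unif: "(\<integral>\<omega>. indicat_real {p. p l = j} (C u \<omega>) \<partial>M) = 1 / real CARD('d)"
    by (simp add: prob_bij_value)
  have gm: "(\<lambda>\<omega>. g (\<lambda>w. c w \<omega>)) \<in> borel_measurable M"
  proof -
    have "g (\<lambda>w. c w \<omega>) = g (\<lambda>w. (\<lambda>i\<in>{..length u}. c (take i u) \<omega>) (length w))" for \<omega>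
      by (rule g) (simp add: min_absorb2)
    moreover have "(\<lambda>\<omega>. g (\<lambda>w. (\<lambda>i\<in>{..length u}. c (take i u) \<omega>) (length w))) \<in> borel_measurable M"
    proof (rule measurable_compose[where f = "\<lambda>\<omega>. \<lambda>i\<in>{..length u}. c (take i u) \<omega>"])
      show "(\<lambda>\<omega>. \<lambda>i\<in>{..length u}. c (take i u) \<omega>) \<in> measurable M (PiM {..length u} (\<lambda>_. count_space UNIV))"
        by measurable
      show "(\<lambda>\<phi>. g (\<lambda>w. \<phi> (length w))) \<in> borel_measurable (PiM {..length u} (\<lambda>_. count_space UNIV))"
        by (subst count_space_PiM_finite) auto
    qed
    ultimately show ?thesis by simp
  qed
  have "(\<integral>\<omega>. g (\<lambda>w. c w \<omega>) * indicator {\<omega>. c (u @ [l]) \<omega> = j} \<omega> \<partial>M)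
      = (\<integral>\<omega>. g (col (restrict (\<lambda>v. C v \<omega>) P)) * indicat_real {p. p l = j} (C u \<omega>) \<partial>M)"
  proof (rule integral_cong_AE)
    show "AE \<omega> in M. g (\<lambda>w. c w \<omega>) * indicator {\<omega>. c (u @ [l]) \<omega> = j} \<omega>
       = g (col (restrict (\<lambda>v. C v \<omega>) P)) * indicat_real {p. p l = j} (C u \<omega>)"
      using col_g by eventually_elim (simp add: C_def indicator_def)
    show "(\<lambda>\<omega>. g (\<lambda>w. c w \<omega>) * indicat_real {\<omega>. c (u @ [l]) \<omega> = j} \<omega>) \<in> borel_measurable M"
      using gm by measurable
  qed measurable
  also have "\<dots> = (\<integral>\<omega>. g (col (restrict (\<lambda>v. C v \<omega>) P)) \<partial>M) / real CARD('d)"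
    using M.indep_var_lebesgue_integral[OF ind int1 int2] unif by simp
  also have "(\<integral>\<omega>. g (col (restrict (\<lambda>v. C v \<omega>) P)) \<partial>M) = (\<integral>\<omega>. g (\<lambda>w. c w \<omega>) \<partial>M)"
    using col_g gm by (intro integral_cong_AE) auto
  finally show ?thesis .
qed

text \<open>Given the colours, the label of the new edge contributes a factor that depends only on the colours
  \<open>k\<close> and \<open>j\<close> of its endpoints; what remains is a function of the colours up to \<open>u\<close> times the
  indicator of the new colour, to which \<open>next_colour_independent\<close> applies.\<close>

lemma markov_step_boxes:
  assumes B: "\<And>i. B i \<in> sets borel" and B': "B' \<in> sets borel"
  shows "measure M {\<omega>\<in>space M. c u \<omega> = k \<and> c (u @ [l]) \<omega> = j
            \<and> (\<forall>i\<in>{1..length u}. \<zeta> (take i u) \<omega> \<in> B i) \<and> \<zeta> (u @ [l]) \<omega> \<in> B'}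
    = measure M {\<omega>\<in>space M. c u \<omega> = k \<and> (\<forall>i\<in>{1..length u}. \<zeta> (take i u) \<omega> \<in> B i)}
        / real CARD('d) * measure (distr N borel (\<xi> k j)) B'"
proof -
  let ?n = "length u" and ?u' = "u @ [l]"
  define \<nu> where "\<nu> a b = measure (distr N borel (\<xi> a b))" for a b
  define Q where "Q \<kappa> = (\<Prod>i\<in>{1..?n}. \<nu> (\<kappa> (take (i-1) u)) (\<kappa> (take i u)) (B i))" for \<kappa> :: "'d list \<Rightarrow> 'd"
  define g where "g \<kappa> = (if \<kappa> u = k then Q \<kappa> else 0)" for \<kappa> :: "'d list \<Rightarrow> 'd"
  define D D' where "D = {\<omega>\<in>space M. c u \<omega> = k}" and "D' = {\<omega>\<in>space M. c u \<omega> = k \<and> c ?u' \<omega> = j}"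
  have sp: "space (colour_algebra M c) = space M" by (simp add: colour_algebra_def)
  note [measurable] = measurable_colour_algebra
  have D: "D \<in> sets (colour_algebra M c)" unfolding D_def sp[symmetric] by measurable
  have D': "D' \<in> sets (colour_algebra M c)" unfolding D'_def sp[symmetric] by measurable
  let ?B = "\<lambda>i. if i = Suc ?n then B' else B i"
  have interval: "{1..length ?u'} = insert (Suc ?n) {1..?n}" by auto
  have last: "(\<Prod>i\<in>{1..length ?u'}. \<nu> (\<kappa> (take (i-1) ?u')) (\<kappa> (take i ?u')) (?B i))
      = Q \<kappa> * \<nu> (\<kappa> u) (\<kappa> ?u') B'" for \<kappa>
  proof -
    have "(\<Prod>i\<in>{1..?n}. \<nu> (\<kappa> (take (i-1) ?u')) (\<kappa> (take i ?u')) (?B i)) = Q \<kappa>"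
      unfolding Q_def by (rule prod.cong) auto
    then show ?thesis unfolding interval by (subst prod.insert) (auto simp: mult.commute)
  qed
  have "measure M {\<omega>\<in>space M. c u \<omega> = k \<and> c ?u' \<omega> = j
            \<and> (\<forall>i\<in>{1..?n}. \<zeta> (take i u) \<omega> \<in> B i) \<and> \<zeta> ?u' \<omega> \<in> B'}
      = measure M {\<omega>\<in>D'. \<forall>i\<in>{1..length ?u'}. \<zeta> (take i ?u') \<omega> \<in> ?B i}"
    unfolding D'_def interval by (rule arg_cong[where f = "measure M"]) auto
  also have "\<dots> = (\<integral>\<omega>. indicator D' \<omega> *
        (\<Prod>i\<in>{1..length ?u'}. \<nu> (c (take (i-1) ?u') \<omega>) (c (take i ?u') \<omega>) (?B i)) \<partial>M)"
    unfolding \<nu>_def using B B' by (intro label_box_given_colours[OF D']) auto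
  also have "\<dots> = (\<integral>\<omega>. (g (\<lambda>w. c w \<omega>) * indicator {\<omega>. c ?u' \<omega> = j} \<omega>) * \<nu> k j B' \<partial>M)"
  proof (rule Bochner_Integration.integral_cong[OF refl])
    fix \<omega> assume "\<omega> \<in> space M"
    then show "indicator D' \<omega> *
        (\<Prod>i\<in>{1..length ?u'}. \<nu> (c (take (i-1) ?u') \<omega>) (c (take i ?u') \<omega>) (?B i))
      = (g (\<lambda>w. c w \<omega>) * indicator {\<omega>. c ?u' \<omega> = j} \<omega>) * \<nu> k j B'"
      unfolding last[of "\<lambda>w. c w \<omega>"] by (auto simp: D'_def g_def indicator_def)
  qed
  also have "\<dots> = (\<integral>\<omega>. g (\<lambda>w. c w \<omega>) * indicator {\<omega>. c ?u' \<omega> = j} \<omega> \<partial>M) * \<nu> k j B'"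
    by (rule integral_mult_left_zero)
  also have "(\<integral>\<omega>. g (\<lambda>w. c w \<omega>) * indicator {\<omega>. c ?u' \<omega> = j} \<omega> \<partial>M)
      = (\<integral>\<omega>. g (\<lambda>w. c w \<omega>) \<partial>M) / real CARD('d)"
  proof (rule next_colour_independent)
    fix \<kappa> \<kappa>' :: "'d list \<Rightarrow> 'd"
    assume eq: "\<And>i. i \<le> ?n \<Longrightarrow> \<kappa> (take i u) = \<kappa>' (take i u)"
    have "Q \<kappa> = Q \<kappa>'" unfolding Q_def by (rule prod.cong) (auto simp: eq)
    with eq[of ?n] show "g \<kappa> = g \<kappa>'" by (simp add: g_def)
  qed
  also have "(\<integral>\<omega>. g (\<lambda>w. c w \<omega>) \<partial>M) = (\<integral>\<omega>. indicator D \<omega> *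
        (\<Prod>i\<in>{1..?n}. \<nu> (c (take (i-1) u) \<omega>) (c (take i u) \<omega>) (B i)) \<partial>M)"
    by (rule Bochner_Integration.integral_cong) (auto simp: D_def g_def Q_def indicator_def)
  also have "\<dots> = measure M {\<omega>\<in>D. \<forall>i\<in>{1..?n}. \<zeta> (take i u) \<omega> \<in> B i}"
    unfolding \<nu>_def using B by (intro label_box_given_colours[OF D, symmetric])
  finally show ?thesis by (simp add: D_def \<nu>_def conj_assoc)
qed

text \<open>Boxes determine a finite measure on the space of label vectors, and the value of \<open>u\<close> is a
  measurable function of the label vector of its path.\<close>

lemma markov_step_sets:
  assumes S: "S \<in> sets borel" and B': "B' \<in> sets borel"
  shows "emeasure M {\<omega>\<in>space M. c u \<omega> = k \<and> c (u @ [l]) \<omega> = j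
            \<and> vertex_value \<zeta> u \<omega> \<in> S \<and> \<zeta> (u @ [l]) \<omega> \<in> B'}
    = ennreal (1 / real CARD('d)) * emeasure M {\<omega>\<in>space M. c u \<omega> = k \<and> vertex_value \<zeta> u \<omega> \<in> S}
        * emeasure (distr N borel (\<xi> k j)) B'"
proof -
  note [measurable] = S B'
  define I where "I = {1..length u}"
  define D D' where "D = {\<omega>\<in>space M. c u \<omega> = k}"
    and "D' = {\<omega>\<in>space M. c u \<omega> = k \<and> c (u @ [l]) \<omega> = j \<and> \<zeta> (u @ [l]) \<omega> \<in> B'}"
  have [measurable]: "D \<in> sets M" "D' \<in> sets M" unfolding D_def D'_def by measurable
  define q where "q = ennreal (1 / real CARD('d)) * emeasure (distr N borel (\<xi> k j)) B'"
  define X where "X \<omega> = (\<lambda>i\<in>I. \<zeta> (take i u) \<omega>)" for \<omega>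
  have X[measurable]: "X \<in> measurable M (PiM I (\<lambda>_. borel))"
    unfolding X_def by measurable
  define \<mu>1 where "\<mu>1 = distr (density M (indicator D')) (PiM I (\<lambda>_. borel)) X"
  define \<mu>2 where "\<mu>2 = distr (density M (\<lambda>\<omega>. q * indicator D \<omega>)) (PiM I (\<lambda>_. borel)) X"
  have em1: "emeasure \<mu>1 A = emeasure M {\<omega>\<in>D'. X \<omega> \<in> A}" if "A \<in> sets (PiM I (\<lambda>_. borel))" for A
  proof -
    have "D' \<inter> (X -` A \<inter> space M) = {\<omega>\<in>D'. X \<omega> \<in> A}" by (auto simp: D'_def)
    then have m: "{\<omega>\<in>D'. X \<omega> \<in> A} \<in> sets M"
      using sets.Int[OF \<open>D' \<in> sets M\<close> measurable_sets[OF X that]] by simp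
    have "emeasure \<mu>1 A = (\<integral>\<^sup>+\<omega>. indicator D' \<omega> * indicator (X -` A \<inter> space M) \<omega> \<partial>M)"
      using that by (simp add: \<mu>1_def emeasure_distr emeasure_density)
    also have "\<dots> = (\<integral>\<^sup>+\<omega>. indicator {\<omega>\<in>D'. X \<omega> \<in> A} \<omega> \<partial>M)"
      by (rule nn_integral_cong) (auto simp: indicator_def)
    also have "\<dots> = emeasure M {\<omega>\<in>D'. X \<omega> \<in> A}"
      using m by (rule nn_integral_indicator)
    finally show ?thesis .
  qed
  have em2: "emeasure \<mu>2 A = q * emeasure M {\<omega>\<in>D. X \<omega> \<in> A}" if "A \<in> sets (PiM I (\<lambda>_. borel))" for A
  proof -
    have "D \<inter> (X -` A \<inter> space M) = {\<omega>\<in>D. X \<omega> \<in> A}" by (auto simp: D_def)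
    then have m: "{\<omega>\<in>D. X \<omega> \<in> A} \<in> sets M"
      using sets.Int[OF \<open>D \<in> sets M\<close> measurable_sets[OF X that]] by simp
    have "emeasure \<mu>2 A = (\<integral>\<^sup>+\<omega>. q * indicator D \<omega> * indicator (X -` A \<inter> space M) \<omega> \<partial>M)"
      using that by (simp add: \<mu>2_def emeasure_distr emeasure_density)
    also have "\<dots> = (\<integral>\<^sup>+\<omega>. q * indicator {\<omega>\<in>D. X \<omega> \<in> A} \<omega> \<partial>M)"
      by (rule nn_integral_cong) (auto simp: indicator_def)
    also have "\<dots> = q * emeasure M {\<omega>\<in>D. X \<omega> \<in> A}"
      using m by (rule nn_integral_cmult_indicator)
    finally show ?thesis .
  qed
  have "\<mu>1 = \<mu>2"
  proof (rule measure_eqI_PiM_finite[where I = I and M = "\<lambda>_. borel" and A = "\<lambda>_. PiE I (\<lambda>_. UNIV)"])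
    fix A :: "nat \<Rightarrow> real set" assume "\<And>i. i \<in> I \<Longrightarrow> A i \<in> sets borel"
    then have A: "PiE I A \<in> sets (PiM I (\<lambda>_. borel))" by (intro sets_PiM_I_finite) (auto simp: I_def)
    let ?A = "\<lambda>i. if i \<in> I then A i else UNIV"
    have A': "?A i \<in> sets borel" for i using \<open>\<And>i. i \<in> I \<Longrightarrow> A i \<in> sets borel\<close> by auto
    have "{\<omega>\<in>D'. X \<omega> \<in> PiE I A} = {\<omega>\<in>space M. c u \<omega> = k \<and> c (u @ [l]) \<omega> = j
            \<and> (\<forall>i\<in>I. \<zeta> (take i u) \<omega> \<in> ?A i) \<and> \<zeta> (u @ [l]) \<omega> \<in> B'}"
      by (auto simp: D'_def X_def PiE_iff)
    moreover have "{\<omega>\<in>D. X \<omega> \<in> PiE I A} =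
        {\<omega>\<in>space M. c u \<omega> = k \<and> (\<forall>i\<in>I. \<zeta> (take i u) \<omega> \<in> ?A i)}"
      by (auto simp: D_def X_def PiE_iff)
    moreover have "emeasure M {\<omega>\<in>space M. c u \<omega> = k \<and> c (u @ [l]) \<omega> = j
            \<and> (\<forall>i\<in>I. \<zeta> (take i u) \<omega> \<in> ?A i) \<and> \<zeta> (u @ [l]) \<omega> \<in> B'}
        = q * emeasure M {\<omega>\<in>space M. c u \<omega> = k \<and> (\<forall>i\<in>I. \<zeta> (take i u) \<omega> \<in> ?A i)}"
    proof -
      interpret D: prob_space "distr N borel (\<xi> k j)" by (rule N.prob_space_distr) measurable
      show ?thesis
        unfolding q_def M.emeasure_eq_measure D.emeasure_eq_measure
          markov_step_boxes[where B = ?A and u = u, OF A' B', folded I_def]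
        by (simp add: mult_ac flip: ennreal_mult)
    qed
    ultimately show "emeasure \<mu>1 (PiE I A) = emeasure \<mu>2 (PiE I A)"
      unfolding em1[OF A] em2[OF A] by (simp only:)
  next
    have "PiE I (\<lambda>_. UNIV) \<in> sets (PiM I (\<lambda>_. borel :: real measure))"
      by (intro sets_PiM_I_finite) (auto simp: I_def)
    then show "emeasure \<mu>1 (PiE I (\<lambda>_. UNIV)) \<noteq> \<infinity>" for i :: nat by (simp add: em1)
  qed (auto simp: \<mu>1_def \<mu>2_def space_PiM I_def intro!: prod_algebraI_finite)
  moreover define T where "T = {\<phi> \<in> space (PiM I (\<lambda>_. borel)). (\<Prod>i\<in>I. \<phi> i) \<in> S}"
  have T: "T \<in> sets (PiM I (\<lambda>_. borel))" unfolding T_def by measurable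
  moreover have "X \<omega> \<in> T \<longleftrightarrow> vertex_value \<zeta> u \<omega> \<in> S" for \<omega>
    by (auto simp: T_def X_def vertex_value_def space_PiM I_def)
  ultimately have "emeasure M {\<omega>\<in>D'. vertex_value \<zeta> u \<omega> \<in> S} = q * emeasure M {\<omega>\<in>D. vertex_value \<zeta> u \<omega> \<in> S}"
    using em1[OF T] em2[OF T] by simp
  then show ?thesis by (simp add: D_def D'_def q_def conj_ac mult_ac)
qed

lemma vertex_value_snoc: "vertex_value \<zeta> (u @ [l]) \<omega> = vertex_value \<zeta> u \<omega> * \<zeta> (u @ [l]) \<omega>"
  by (simp add: vertex_value_def atLeastAtMostSuc_conv mult.commute)

text \<open>On the event that \<open>u\<close> has colour \<open>k\<close> and its child has colour \<open>j\<close>, the value of \<open>u\<close> and the label of the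
  new edge have, up to the factor \<open>1 / d\<close>, a product law.  The law of the label is expressed through
  \<open>\<xi> k j\<close>, with the integral over \<open>N\<close> on the outside, so that estimates for a fixed multiplier
  can be integrated.\<close>

lemma markov_step_parent:
  assumes [measurable]: "f \<in> borel_measurable borel"
  shows "(\<integral>\<^sup>+\<omega>. indicator {\<omega>. c u \<omega> = k \<and> c (u @ [l]) \<omega> = j} \<omega> * f (vertex_value \<zeta> (u @ [l]) \<omega>) \<partial>M)
    = ennreal (1 / real CARD('d)) *
       (\<integral>\<^sup>+x. (\<integral>\<^sup>+\<omega>. indicator {\<omega>. c u \<omega> = k} \<omega> * f (vertex_value \<zeta> u \<omega> * \<xi> k j x) \<partial>M) \<partial>N)"
proof -
  let ?u' = "u @ [l]" and ?q = "ennreal (1 / real CARD('d))"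
  define D D' where "D = {\<omega>\<in>space M. c u \<omega> = k}" and "D' = {\<omega>\<in>space M. c u \<omega> = k \<and> c ?u' \<omega> = j}"
  have [measurable]: "D \<in> sets M" "D' \<in> sets M" unfolding D_def D'_def by measurable
  define P where "P = distr (density M (indicator D)) borel (vertex_value \<zeta> u)"
  define Q where "Q = distr N borel (\<xi> k j)"
  define J where "J = distr (density M (indicator D')) (borel \<Otimes>\<^sub>M borel) (\<lambda>\<omega>. (vertex_value \<zeta> u \<omega>, \<zeta> ?u' \<omega>))"
  have finP: "finite_measure (density M (indicator D))"
  proof (rule finite_measureI)
    have "emeasure (density M (indicator D)) (space M) \<le> 1"
      by (subst emeasure_density) (simp_all add: M.emeasure_le_1)
    then show "emeasure (density M (indicator D)) (space (density M (indicator D))) \<noteq> \<infinity>"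
      by (auto simp: top_unique)
  qed
  then interpret P: finite_measure P unfolding P_def
    by (rule finite_measure.finite_measure_distr) simp
  interpret Q: prob_space Q unfolding Q_def by (rule N.prob_space_distr) measurable
  interpret PQ: pair_sigma_finite P Q ..
  have q: "ennreal (real CARD('d)) * ?q = 1" by (simp flip: ennreal_mult)
  have J: "emeasure J (S \<times> B') = ?q * (emeasure P S * emeasure Q B')"
    if [measurable]: "S \<in> sets borel" "B' \<in> sets borel" for S B'
  proof -
    have "emeasure J (S \<times> B') = (\<integral>\<^sup>+\<omega>. indicator D' \<omega> * indicator ((\<lambda>\<omega>. (vertex_value \<zeta> u \<omega>, \<zeta> ?u' \<omega>)) -` (S \<times> B') \<inter> space M) \<omega> \<partial>M)"
      unfolding J_def by (subst emeasure_distr) (simp_all add: emeasure_density)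
    also have "\<dots> = (\<integral>\<^sup>+\<omega>. indicator {\<omega>\<in>space M. c u \<omega> = k \<and> c ?u' \<omega> = j
            \<and> vertex_value \<zeta> u \<omega> \<in> S \<and> \<zeta> ?u' \<omega> \<in> B'} \<omega> \<partial>M)"
      by (rule nn_integral_cong) (auto simp: indicator_def D'_def)
    also have "\<dots> = ?q * emeasure M {\<omega>\<in>space M. c u \<omega> = k \<and> vertex_value \<zeta> u \<omega> \<in> S} * emeasure Q B'"
      unfolding Q_def by (subst nn_integral_indicator) (auto simp: markov_step_sets)
    also have "emeasure M {\<omega>\<in>space M. c u \<omega> = k \<and> vertex_value \<zeta> u \<omega> \<in> S}
        = (\<integral>\<^sup>+\<omega>. indicator {\<omega>\<in>space M. c u \<omega> = k \<and> vertex_value \<zeta> u \<omega> \<in> S} \<omega> \<partial>M)"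
      by (subst nn_integral_indicator) auto
    also have "\<dots> = (\<integral>\<^sup>+\<omega>. indicator D \<omega> * indicator (vertex_value \<zeta> u -` S \<inter> space M) \<omega> \<partial>M)"
      by (rule nn_integral_cong) (auto simp: indicator_def D_def)
    also have "\<dots> = emeasure P S"
      unfolding P_def by (subst emeasure_distr) (simp_all add: emeasure_density)
    finally show ?thesis by (simp add: mult.assoc)
  qed
  have "P \<Otimes>\<^sub>M Q = density J (\<lambda>_. ennreal (real CARD('d)))"
  proof (rule pair_measure_eqI)
    fix S B' assume "S \<in> sets P" "B' \<in> sets Q"
    then have SB: "S \<in> sets borel" "B' \<in> sets borel" by (auto simp: P_def Q_def)
    then have "S \<times> B' \<in> sets J" by (simp add: J_def)
    then have "emeasure (density J (\<lambda>_. ennreal (real CARD('d)))) (S \<times> B')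
      = ennreal (real CARD('d)) * emeasure J (S \<times> B')"
      by (simp add: emeasure_density_const)
    also have "\<dots> = emeasure P S * emeasure Q B'"
      by (simp only: J[OF SB] mult.assoc[symmetric] q mult_1_left)
    finally show "emeasure P S * emeasure Q B' = emeasure (density J (\<lambda>_. ennreal (real CARD('d)))) (S \<times> B')" ..
  next
    show "sigma_finite_measure P" "sigma_finite_measure Q" by unfold_locales
    show "sets (P \<Otimes>\<^sub>M Q) = sets (density J (\<lambda>_. ennreal (real CARD('d))))"
      by (simp add: P_def Q_def J_def cong: sets_pair_measure_cong)
  qed
  then have PQ: "(\<integral>\<^sup>+p. f (fst p * snd p) \<partial>(P \<Otimes>\<^sub>M Q)) = ennreal (real CARD('d)) * (\<integral>\<^sup>+p. f (fst p * snd p) \<partial>J)"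
    by (subst nn_integral_cmult[symmetric]) (simp_all add: nn_integral_density J_def)
  have "(\<integral>\<^sup>+\<omega>. indicator {\<omega>. c u \<omega> = k \<and> c ?u' \<omega> = j} \<omega> * f (vertex_value \<zeta> ?u' \<omega>) \<partial>M)
      = (\<integral>\<^sup>+\<omega>. indicator D' \<omega> * f (vertex_value \<zeta> u \<omega> * \<zeta> ?u' \<omega>) \<partial>M)"
    by (rule nn_integral_cong) (simp add: D'_def indicator_def vertex_value_snoc)
  also have "\<dots> = (\<integral>\<^sup>+p. f (fst p * snd p) \<partial>J)"
    unfolding J_def by (subst nn_integral_distr) (simp_all add: nn_integral_density)
  also have "\<dots> = ?q * (\<integral>\<^sup>+p. f (fst p * snd p) \<partial>(P \<Otimes>\<^sub>M Q))"
    by (simp only: PQ mult.assoc[symmetric] q mult.commute[of ?q] mult_1_left)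
  also have "(\<integral>\<^sup>+p. f (fst p * snd p) \<partial>(P \<Otimes>\<^sub>M Q)) = (\<integral>\<^sup>+z. (\<integral>\<^sup>+y. f (y * z) \<partial>P) \<partial>Q)"
    by (subst PQ.nn_integral_snd[symmetric]) (simp_all add: P_def Q_def)
  also have "\<dots> = (\<integral>\<^sup>+z. (\<integral>\<^sup>+\<omega>. indicator D \<omega> * f (vertex_value \<zeta> u \<omega> * z) \<partial>M) \<partial>Q)"
    unfolding P_def by (simp add: nn_integral_distr nn_integral_density)
  also have "\<dots> = (\<integral>\<^sup>+x. (\<integral>\<^sup>+\<omega>. indicator D \<omega> * f (vertex_value \<zeta> u \<omega> * \<xi> k j x) \<partial>M) \<partial>N)"
    unfolding Q_def by (rule nn_integral_distr) measurable
  also have "\<dots> = (\<integral>\<^sup>+x. (\<integral>\<^sup>+\<omega>. indicator {\<omega>. c u \<omega> = k} \<omega> * f (vertex_value \<zeta> u \<omega> * \<xi> k j x) \<partial>M) \<partial>N)"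
    by (intro nn_integral_cong) (simp add: D_def indicator_def)
  finally show ?thesis .
qed

section \<open>Expectations over a level of the tree\<close>

text \<open>Tails (\<open>f = indicator {x..}\<close>) and moments (\<open>f = pos_powr s\<close>) are treated as values of one linear functional, so
  that they obey the same recursion over the levels.\<close>

definition level_expectation :: "nat \<Rightarrow> 'd \<Rightarrow> (real \<Rightarrow> ennreal) \<Rightarrow> ennreal" where
  "level_expectation n j f =
     (\<Sum>u\<in>{u. length u = n}. \<integral>\<^sup>+\<omega>. indicator {\<omega>. c u \<omega> = j} \<omega> * f (vertex_value \<zeta> u \<omega>) \<partial>M)"

lemma finite_level: "finite {u::'d list. length u = n}"
  using finite_lists_length_eq[of "UNIV::'d set" n] by simp

lemma level_expectation_mono:
  assumes "\<And>y. f y \<le> g y"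
  shows "level_expectation n j f \<le> level_expectation n j g"
  unfolding level_expectation_def by (intro sum_mono nn_integral_mono mult_left_mono assms) simp

lemma level_expectation_add:
  assumes [measurable]: "f \<in> borel_measurable borel" "g \<in> borel_measurable borel"
  shows "level_expectation n j (\<lambda>y. f y + g y) = level_expectation n j f + level_expectation n j g"
  unfolding level_expectation_def by (simp add: distrib_left nn_integral_add sum.distrib)

lemma level_expectation_cmult:
  assumes [measurable]: "f \<in> borel_measurable borel"
  shows "level_expectation n j (\<lambda>y. a * f y) = a * level_expectation n j f"
  unfolding level_expectation_def
  by (simp add: mult.left_commute[of _ a] nn_integral_cmult sum_distrib_left)

lemma level_expectation_suminf:
  assumes [measurable]: "\<And>i. f i \<in> borel_measurable borel"
  shows "level_expectation n j (\<lambda>y. \<Sum>i. f i y) = (\<Sum>i. level_expectation n j (f i))"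
  unfolding level_expectation_def
  by (simp add: ennreal_suminf_cmult[symmetric] nn_integral_suminf suminf_sum del: ennreal_suminf_cmult)

lemma level_expectation_0: "level_expectation 0 j f = (if j = r then f 1 else 0)"
proof -
  have "(\<integral>\<^sup>+\<omega>. indicator {\<omega>. c [] \<omega> = j} \<omega> * f 1 \<partial>M) = (\<integral>\<^sup>+\<omega>. (if j = r then f 1 else 0) \<partial>M)"
    by (rule nn_integral_cong_AE) (use root_colour in \<open>eventually_elim, auto simp: indicator_def\<close>)
  then show ?thesis
    by (simp add: level_expectation_def vertex_value_def M.emeasure_space_1)
qed

text \<open>Each vertex has \<open>d\<close> children, which cancels the probability \<open>1 / d\<close> of each colour of a child.\<close>

lemma level_expectation_Suc:
  assumes f[measurable]: "f \<in> borel_measurable borel"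
  shows "level_expectation (Suc n) j f =
    (\<Sum>k\<in>UNIV. \<integral>\<^sup>+x. level_expectation n k (\<lambda>y. f (y * \<xi> k j x)) \<partial>N)"
proof -
  let ?V = "\<lambda>n. {u::'d list. length u = n}"
  define I where "I u k = (\<integral>\<^sup>+x. (\<integral>\<^sup>+\<omega>. indicator {\<omega>. c u \<omega> = k} \<omega> * f (vertex_value \<zeta> u \<omega> * \<xi> k j x) \<partial>M) \<partial>N)"
    for u k
  define q where "q = ennreal (1 / real CARD('d))"
  have q: "of_nat CARD('d) * q = 1"
    by (simp add: q_def ennreal_of_nat_eq_real_of_nat flip: ennreal_mult)
  have inj: "inj_on (\<lambda>(u, l). u @ [l]) (?V n \<times> UNIV)" by (auto simp: inj_on_def)
  have image: "?V (Suc n) = (\<lambda>(u, l). u @ [l]) ` (?V n \<times> UNIV)"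
  proof (intro set_eqI iffI)
    fix w :: "'d list" assume "w \<in> ?V (Suc n)"
    then have "w = butlast w @ [last w]" "length (butlast w) = n" by (auto simp flip: length_0_conv)
    then show "w \<in> (\<lambda>(u, l). u @ [l]) ` (?V n \<times> UNIV)" by (intro image_eqI[of _ _ "(butlast w, last w)"]) auto
  qed auto
  have child: "(\<integral>\<^sup>+\<omega>. indicator {\<omega>. c (u @ [l]) \<omega> = j} \<omega> * f (vertex_value \<zeta> (u @ [l]) \<omega>) \<partial>M)
      = q * (\<Sum>k\<in>UNIV. I u k)" for u l
  proof -
    have "(\<integral>\<^sup>+\<omega>. indicator {\<omega>. c (u @ [l]) \<omega> = j} \<omega> * f (vertex_value \<zeta> (u @ [l]) \<omega>) \<partial>M)
      = (\<integral>\<^sup>+\<omega>. (\<Sum>k\<in>UNIV. indicator {\<omega>. c u \<omega> = k \<and> c (u @ [l]) \<omega> = j} \<omega> * f (vertex_value \<zeta> (u @ [l]) \<omega>)) \<partial>M)"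
    proof (rule nn_integral_cong)
      fix \<omega>
      show "indicator {\<omega>. c (u @ [l]) \<omega> = j} \<omega> * f (vertex_value \<zeta> (u @ [l]) \<omega>)
        = (\<Sum>k\<in>UNIV. indicator {\<omega>. c u \<omega> = k \<and> c (u @ [l]) \<omega> = j} \<omega> * f (vertex_value \<zeta> (u @ [l]) \<omega>))"
        by (subst sum.remove[of UNIV "c u \<omega>"]) (auto simp: indicator_def intro!: sum.neutral)
    qed
    also have "\<dots> = (\<Sum>k\<in>UNIV. \<integral>\<^sup>+\<omega>. indicator {\<omega>. c u \<omega> = k \<and> c (u @ [l]) \<omega> = j} \<omega> * f (vertex_value \<zeta> (u @ [l]) \<omega>) \<partial>M)"
      by (rule nn_integral_sum) measurable
    also have "\<dots> = q * (\<Sum>k\<in>UNIV. I u k)"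
      by (simp add: markov_step_parent[OF f] I_def q_def sum_distrib_left)
    finally show ?thesis .
  qed
  have "level_expectation (Suc n) j f = (\<Sum>(u, l)\<in>?V n \<times> (UNIV::'d set). q * (\<Sum>k\<in>UNIV. I u k))"
    unfolding level_expectation_def image sum.reindex[OF inj]
    by (rule sum.cong) (auto simp: child)
  also have "\<dots> = (\<Sum>u\<in>?V n. \<Sum>l\<in>(UNIV::'d set). q * (\<Sum>k\<in>UNIV. I u k))"
    by (rule sum.cartesian_product[symmetric])
  also have "\<dots> = (\<Sum>u\<in>?V n. \<Sum>k\<in>UNIV. I u k)"
    by (simp add: mult.assoc[symmetric] q)
  also have "\<dots> = (\<Sum>k\<in>UNIV. \<Sum>u\<in>?V n. I u k)" by (rule sum.swap)
  also have "\<dots> = (\<Sum>k\<in>UNIV. \<integral>\<^sup>+x. level_expectation n k (\<lambda>y. f (y * \<xi> k j x)) \<partial>N)"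
  proof (rule sum.cong[OF refl])
    fix k
    have "(\<lambda>x. \<integral>\<^sup>+\<omega>. indicator {\<omega>. c u \<omega> = k} \<omega> * f (vertex_value \<zeta> u \<omega> * \<xi> k j x) \<partial>M) \<in> borel_measurable N" for u
      by measurable
    then show "(\<Sum>u\<in>?V n. I u k) = (\<integral>\<^sup>+x. level_expectation n k (\<lambda>y. f (y * \<xi> k j x)) \<partial>N)"
      unfolding level_expectation_def I_def by (subst nn_integral_sum) auto
  qed
  finally show ?thesis .
qed

text \<open>Restricting the power to positive arguments makes tail estimates such as \<open>pos_powr_le_slabs\<close>
  hold for all real \<open>y\<close>, although the values are positive only almost surely (\<open>powr\<close> itself does not
  vanish at negative arguments), and keeps multiplicativity under positive multipliers.\<close>

definition pos_powr :: "real \<Rightarrow> real \<Rightarrow> ennreal" where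
  "pos_powr s y = (if 0 < y then ennreal (y powr s) else 0)"

lemma measurable_pos_powr [measurable]: "pos_powr s \<in> borel_measurable borel"
  unfolding pos_powr_def by measurable

lemma level_moment_Suc:
  assumes s: "s \<in> moment_domain N \<xi>"
  shows "level_expectation (Suc n) j (pos_powr s) =
    (\<Sum>k\<in>UNIV. level_expectation n k (pos_powr s) * ennreal (moment_matrix N \<xi> s $ k $ j))"
proof -
  have "(\<integral>\<^sup>+x. level_expectation n k (\<lambda>y. pos_powr s (y * \<xi> k j x)) \<partial>N)
      = level_expectation n k (pos_powr s) * ennreal (moment_matrix N \<xi> s $ k $ j)" for k
  proof -
    have "(\<integral>\<^sup>+x. level_expectation n k (\<lambda>y. pos_powr s (y * \<xi> k j x)) \<partial>N)
      = (\<integral>\<^sup>+x. level_expectation n k (pos_powr s) * ennreal (\<xi> k j x powr s) \<partial>N)"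
    proof (rule nn_integral_cong_AE)
      show "AE x in N. level_expectation n k (\<lambda>y. pos_powr s (y * \<xi> k j x))
         = level_expectation n k (pos_powr s) * ennreal (\<xi> k j x powr s)"
        using xi_positive[of k j]
      proof eventually_elim
        case (elim x)
        then have "pos_powr s (y * \<xi> k j x) = ennreal (\<xi> k j x powr s) * pos_powr s y" for y
          by (simp add: pos_powr_def zero_less_mult_iff powr_mult ennreal_mult mult.commute)
        then have "level_expectation n k (\<lambda>y. pos_powr s (y * \<xi> k j x))
            = ennreal (\<xi> k j x powr s) * level_expectation n k (pos_powr s)"
          by (simp only: level_expectation_cmult[OF measurable_pos_powr])
        then show ?case by (simp only: mult.commute)
      qed
    qed
    also have "\<dots> = level_expectation n k (pos_powr s) * (\<integral>\<^sup>+x. ennreal (\<xi> k j x powr s) \<partial>N)"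
      by (rule nn_integral_cmult) measurable
    also have "(\<integral>\<^sup>+x. ennreal (\<xi> k j x powr s) \<partial>N) = ennreal (moment_matrix N \<xi> s $ k $ j)"
      using moment_integrable[OF s] by (simp add: moment_matrix_nth nn_integral_eq_integral)
    finally show ?thesis .
  qed
  then show ?thesis by (simp add: level_expectation_Suc)
qed

text \<open>Weighting the colours by a right eigenvector of the moment matrix turns the recursion of
  \<open>level_moment_Suc\<close> into multiplication by the eigenvalue.\<close>

lemma level_moment_eigenvector:
  assumes s: "s \<in> moment_domain N \<xi>" and v: "\<And>i. 0 < v i"
    and eig: "\<And>i. (\<Sum>j\<in>UNIV. moment_matrix N \<xi> s $ i $ j * v j) = \<rho> * v i"
  shows "(\<Sum>j\<in>UNIV. ennreal (v j) * level_expectation n j (pos_powr s)) = ennreal (\<rho> ^ n * v r)"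
proof (induction n)
  case 0
  have "(\<Sum>j\<in>UNIV. ennreal (v j) * level_expectation 0 j (pos_powr s)) = (\<Sum>j\<in>UNIV. if j = r then ennreal (v j) else 0)"
    by (rule sum.cong) (auto simp: level_expectation_0 pos_powr_def)
  then show ?case by simp
next
  case (Suc n)
  let ?m = "moment_matrix N \<xi> s" and ?L = "\<lambda>n k. level_expectation n k (pos_powr s)"
  have m: "0 \<le> ?m $ i $ j" for i j using moment_pos[OF s, of i j] by simp
  have "0 \<le> (\<Sum>j\<in>UNIV. ?m $ r $ j * v j)" using m v by (intro sum_nonneg mult_nonneg_nonneg) (auto simp: less_imp_le)
  then have \<rho>: "0 \<le> \<rho>" using v[of r] by (simp add: eig zero_le_mult_iff)
  have "(\<Sum>j\<in>UNIV. ennreal (v j) * ?L (Suc n) j)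
      = (\<Sum>j\<in>UNIV. \<Sum>k\<in>UNIV. ?L n k * ennreal (?m $ k $ j * v j))"
    using m v by (simp add: level_moment_Suc[OF s] sum_distrib_left ennreal_mult less_imp_le mult_ac)
  also have "\<dots> = (\<Sum>k\<in>UNIV. ?L n k * (\<Sum>j\<in>UNIV. ennreal (?m $ k $ j * v j)))"
    unfolding sum_distrib_left by (rule sum.swap)
  also have "\<dots> = (\<Sum>k\<in>UNIV. ennreal \<rho> * (ennreal (v k) * ?L n k))"
  proof (rule sum.cong[OF refl])
    fix k
    have "(\<Sum>j\<in>UNIV. ennreal (?m $ k $ j * v j)) = ennreal (\<Sum>j\<in>UNIV. ?m $ k $ j * v j)"
      using m v by (intro sum_ennreal) (simp add: less_imp_le)
    also have "\<dots> = ennreal \<rho> * ennreal (v k)"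
      unfolding eig using \<rho> v[of k] by (simp add: ennreal_mult)
    finally show "?L n k * (\<Sum>j\<in>UNIV. ennreal (?m $ k $ j * v j)) = ennreal \<rho> * (ennreal (v k) * ?L n k)"
      by (simp only: mult_ac)
  qed
  also have "\<dots> = ennreal \<rho> * ennreal (\<rho> ^ n * v r)"
    by (simp only: sum_distrib_left[symmetric] Suc)
  also have "\<dots> = ennreal (\<rho> ^ Suc n * v r)"
    using \<rho> v[of r] by (simp add: mult_ac flip: ennreal_mult)
  finally show ?case .
qed

lemma level_moment_upper:
  assumes s: "s \<in> moment_domain N \<xi>"
  obtains C where "0 \<le> C" "\<And>n j. level_expectation n j (pos_powr s) \<le> ennreal (C * perron_root N \<xi> s ^ n)"
proof -
  let ?\<rho> = "perron_root N \<xi> s"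
  obtain v where v: "\<And>i. 0 < v i"
      "\<And>i. (\<Sum>j\<in>UNIV. moment_matrix N \<xi> s $ i $ j * v j) = ?\<rho> * v i"
    using perron_pair[OF s] by metis
  define C where "C = (\<Sum>j\<in>UNIV. v r / v j)"
  have Cj: "v r / v j \<le> C" for j
    unfolding C_def using v(1) by (intro member_le_sum) (auto simp: less_imp_le)
  have "0 \<le> v r / v r" using v(1)[of r] by simp
  then have "0 \<le> C" using Cj[of r] by linarith
  moreover have "level_expectation n j (pos_powr s) \<le> ennreal (C * ?\<rho> ^ n)" for n j
  proof -
    let ?L = "level_expectation n j (pos_powr s)"
    have "ennreal (v j) * ?L \<le> (\<Sum>j\<in>UNIV. ennreal (v j) * level_expectation n j (pos_powr s))"
      by (rule member_le_sum) auto
    also have "\<dots> = ennreal (?\<rho> ^ n * v r)" by (rule level_moment_eigenvector[OF s v])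
    finally have "ennreal (1 / v j) * (ennreal (v j) * ?L) \<le> ennreal (1 / v j) * ennreal (?\<rho> ^ n * v r)"
      by (rule mult_left_mono) simp
    also have "\<dots> = ennreal (v r / v j * ?\<rho> ^ n)"
      using v(1)[of j] v(1)[of r] perron_root_pos[OF s] by (simp add: mult_ac flip: ennreal_mult)
    also have "\<dots> \<le> ennreal (C * ?\<rho> ^ n)"
      using Cj perron_root_pos[OF s] by (intro ennreal_leI mult_right_mono) auto
    also have "ennreal (1 / v j) * (ennreal (v j) * ?L) = ?L"
      using v(1)[of j] by (simp add: mult.assoc[symmetric] flip: ennreal_mult)
    finally show ?thesis .
  qed
  ultimately show thesis by (rule that)
qed

text \<open>One further step redistributes the eigenvector-weighted moment of level \<open>n\<close> over all colours to the
  colour of the root, because all entries of the moment matrix are positive.\<close>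

lemma level_moment_lower:
  assumes s: "s \<in> moment_domain N \<xi>"
  obtains C where "0 < C" "\<And>n. ennreal (C * perron_root N \<xi> s ^ n) \<le> level_expectation (Suc n) r (pos_powr s)"
proof -
  let ?\<rho> = "perron_root N \<xi> s" and ?m = "moment_matrix N \<xi> s"
  obtain v where v: "\<And>i. 0 < v i"
      "\<And>i. (\<Sum>j\<in>UNIV. ?m $ i $ j * v j) = ?\<rho> * v i"
    using perron_pair[OF s] by metis
  define b where "b = Min (range (\<lambda>k. ?m $ k $ r / v k))"
  have "b \<in> range (\<lambda>k. ?m $ k $ r / v k)" unfolding b_def by (rule Min_in) auto
  then have b: "0 < b" using v(1) moment_pos[OF s] by auto
  have bk: "b * v k \<le> ?m $ k $ r" for k
  proof -
    have "b \<le> ?m $ k $ r / v k" unfolding b_def by (rule Min_le) auto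
    then show ?thesis using v(1)[of k] by (simp add: le_divide_eq)
  qed
  have "ennreal (b * v r * ?\<rho> ^ n) \<le> level_expectation (Suc n) r (pos_powr s)" for n
  proof -
    have "ennreal (b * v r * ?\<rho> ^ n) = ennreal b * ennreal (?\<rho> ^ n * v r)"
      using b v(1)[of r] perron_root_pos[OF s] by (simp add: mult_ac flip: ennreal_mult)
    also have "\<dots> = (\<Sum>k\<in>UNIV. level_expectation n k (pos_powr s) * ennreal (b * v k))"
      using b v(1) unfolding level_moment_eigenvector[OF s v, symmetric]
      by (simp add: sum_distrib_left ennreal_mult less_imp_le mult_ac)
    also have "\<dots> \<le> (\<Sum>k\<in>UNIV. level_expectation n k (pos_powr s) * ennreal (?m $ k $ r))"
      by (intro sum_mono mult_left_mono ennreal_leI bk) simp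
    finally show ?thesis by (simp add: level_moment_Suc[OF s])
  qed
  moreover have "0 < b * v r" using b v(1) by simp
  ultimately show thesis by (intro that)
qed

text \<open>A vertex of level \<open>n\<close> with the colour of the root is the root of a tree with the same law, in which
  values are multiplied by its own value.  Formally this is an induction on the number \<open>m\<close> of
  further levels, where a multiplier \<open>z\<close> replaces the threshold \<open>y\<close> by \<open>y / z\<close> on both sides.\<close>

lemma level_tail_supermultiplicative:
  assumes x: "0 < x"
  shows "level_expectation n r (indicator {x..}) * level_expectation m j (indicator {y..})
    \<le> level_expectation (n + m) j (indicator {x * y..})"
proof (induction m arbitrary: j y)
  case 0
  show ?case
  proof (cases "j = r \<and> y \<le> 1")
    case True
    then have "x * y \<le> x" using x by (simp add: mult_left_le)
    then have "level_expectation n r (indicator {x..}) \<le> level_expectation n r (indicator {x * y..})"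
      by (intro level_expectation_mono) (auto simp: indicator_def)
    with True show ?thesis by (simp add: level_expectation_0)
  qed (auto simp: level_expectation_0)
next
  case (Suc m)
  let ?T = "level_expectation n r (indicator {x..})"
  have scale: "level_expectation i k (\<lambda>w. indicator {z..} (w * \<xi> k j a)) = level_expectation i k (indicator {z / \<xi> k j a..})"
    if "0 < \<xi> k j a" for i k z a
  proof -
    have "(\<lambda>w. indicator {z..} (w * \<xi> k j a) :: ennreal) = indicator {z / \<xi> k j a..}"
      using that by (auto simp: fun_eq_iff indicator_def divide_le_eq)
    then show ?thesis by simp
  qed
  have "(\<integral>\<^sup>+a. ?T * level_expectation m k (\<lambda>w. indicator {y..} (w * \<xi> k j a)) \<partial>N)
      \<le> (\<integral>\<^sup>+a. level_expectation (n + m) k (\<lambda>w. indicator {x * y..} (w * \<xi> k j a)) \<partial>N)" for k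
  proof (rule nn_integral_mono_AE)
    show "AE a in N. ?T * level_expectation m k (\<lambda>w. indicator {y..} (w * \<xi> k j a))
       \<le> level_expectation (n + m) k (\<lambda>w. indicator {x * y..} (w * \<xi> k j a))"
      using xi_positive[of k j]
    proof eventually_elim
      case (elim a)
      show ?case using Suc[of k "y / \<xi> k j a"] by (simp add: scale[OF elim])
    qed
  qed
  moreover have "(\<integral>\<^sup>+a. ?T * level_expectation m k (\<lambda>w. indicator {y..} (w * \<xi> k j a)) \<partial>N)
      = ?T * (\<integral>\<^sup>+a. level_expectation m k (\<lambda>w. indicator {y..} (w * \<xi> k j a)) \<partial>N)" for k
    unfolding level_expectation_def by (rule nn_integral_cmult) measurable
  ultimately show ?case
    by (simp add: level_expectation_Suc sum_distrib_left sum_mono)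
qed

lemma level_tail_power:
  assumes "0 < x"
  shows "level_expectation n r (indicator {x..}) ^ k \<le> level_expectation (k * n) r (indicator {x ^ k..})"
proof (induction k)
  case 0
  show ?case by (simp add: level_expectation_0)
next
  case (Suc k)
  have "level_expectation n r (indicator {x..}) ^ Suc k
      \<le> level_expectation n r (indicator {x..}) * level_expectation (k * n) r (indicator {x ^ k..})"
    using Suc by (simp add: mult_left_mono)
  also have "\<dots> \<le> level_expectation (n + k * n) r (indicator {x * x ^ k..})"
    by (rule level_tail_supermultiplicative[OF assms])
  finally show ?case by simp
qed

lemma expected_count_eq_levels:
  "expected_count M \<zeta> x = (\<Sum>n. \<Sum>j\<in>UNIV. level_expectation n j (indicator {x..}))"
proof -
  define p where "p u = (\<integral>\<^sup>+\<omega>. indicator {x..} (vertex_value \<zeta> u \<omega>) \<partial>M)" for u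
  have "expected_count M \<zeta> x = (\<integral>\<^sup>+\<omega>. \<integral>\<^sup>+u. indicator {x..} (vertex_value \<zeta> u \<omega>) \<partial>count_space UNIV \<partial>M)"
    unfolding expected_count_def vertex_count_def
  proof (rule nn_integral_cong)
    fix \<omega>
    have "emeasure (count_space UNIV) {u. x \<le> vertex_value \<zeta> u \<omega>}
        = (\<integral>\<^sup>+u. indicator {u. x \<le> vertex_value \<zeta> u \<omega>} u \<partial>count_space UNIV)" by simp
    also have "\<dots> = (\<integral>\<^sup>+u. indicator {x..} (vertex_value \<zeta> u \<omega>) \<partial>count_space UNIV)"
      by (rule nn_integral_cong) (simp add: indicator_def)
    finally show "emeasure (count_space UNIV) {u. x \<le> vertex_value \<zeta> u \<omega>}
        = (\<integral>\<^sup>+u. indicator {x..} (vertex_value \<zeta> u \<omega>) \<partial>count_space UNIV)" .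
  qed
  also have "\<dots> = (\<integral>\<^sup>+u. p u \<partial>count_space UNIV)"
    unfolding p_def by (rule nn_integral_count_space_nn_integral) auto
  also have "\<dots> = (\<integral>\<^sup>+u. (\<Sum>n. p u * indicator {u. length u = n} u) \<partial>count_space UNIV)"
  proof (rule nn_integral_cong)
    fix u :: "'d list"
    have "(\<Sum>n. p u * indicator {u. length u = n} u) = (\<Sum>n\<in>{length u}. p u * indicator {u. length u = n} u)"
      by (rule suminf_finite) (auto simp: indicator_def)
    then show "p u = (\<Sum>n. p u * indicator {u. length u = n} u)" by simp
  qed
  also have "\<dots> = (\<Sum>n. \<integral>\<^sup>+u. p u * indicator {u. length u = n} u \<partial>count_space UNIV)"
    by (rule nn_integral_suminf) simp
  also have "\<dots> = (\<Sum>n. \<Sum>j\<in>UNIV. level_expectation n j (indicator {x..}))"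
  proof (rule arg_cong[where f = suminf], rule ext)
    fix n
    have "(\<integral>\<^sup>+u. p u * indicator {u. length u = n} u \<partial>count_space UNIV) = (\<Sum>u\<in>{u. length u = n}. p u)"
      using finite_level by (simp add: nn_integral_indicator_finite)
    also have "\<dots> = (\<Sum>u\<in>{u. length u = n}. \<Sum>j\<in>UNIV. \<integral>\<^sup>+\<omega>. indicator {\<omega>. c u \<omega> = j} \<omega> * indicator {x..} (vertex_value \<zeta> u \<omega>) \<partial>M)"
    proof (rule sum.cong[OF refl])
      fix u
      have "p u = (\<integral>\<^sup>+\<omega>. (\<Sum>j\<in>UNIV. indicator {\<omega>. c u \<omega> = j} \<omega> * indicator {x..} (vertex_value \<zeta> u \<omega>)) \<partial>M)"
        unfolding p_def
        by (intro nn_integral_cong, subst sum.remove[of UNIV "c u _"]) (auto simp: indicator_def intro!: sum.neutral)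
      also have "\<dots> = (\<Sum>j\<in>UNIV. \<integral>\<^sup>+\<omega>. indicator {\<omega>. c u \<omega> = j} \<omega> * indicator {x..} (vertex_value \<zeta> u \<omega>) \<partial>M)"
        by (rule nn_integral_sum) measurable
      finally show "p u = (\<Sum>j\<in>UNIV. \<integral>\<^sup>+\<omega>. indicator {\<omega>. c u \<omega> = j} \<omega> * indicator {x..} (vertex_value \<zeta> u \<omega>) \<partial>M)" .
    qed
    also have "\<dots> = (\<Sum>j\<in>UNIV. level_expectation n j (indicator {x..}))"
      unfolding level_expectation_def by (rule sum.swap)
    finally show "(\<integral>\<^sup>+u. p u * indicator {u. length u = n} u \<partial>count_space UNIV)
        = (\<Sum>j\<in>UNIV. level_expectation n j (indicator {x..}))" .
  qed
  finally show ?thesis .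
qed

text \<open>Markov's inequality with exponent \<open>s\<close> on each level, summed as a geometric series of ratio \<open>\<rho> s\<close>.\<close>

lemma expected_count_upper:
  assumes s: "s \<in> moment_domain N \<xi>" "0 \<le> s" and less: "perron_root N \<xi> s < 1"
  obtains C where "0 \<le> C" "\<And>x. 0 < x \<Longrightarrow> expected_count M \<zeta> x \<le> ennreal (C * x powr - s)"
proof -
  let ?\<rho> = "perron_root N \<xi> s"
  have \<rho>: "0 < ?\<rho>" by (rule perron_root_pos[OF s(1)])
  obtain C where C: "0 \<le> C" "\<And>n j. level_expectation n j (pos_powr s) \<le> ennreal (C * ?\<rho> ^ n)"
    using level_moment_upper[OF s(1)] by metis
  let ?d = "real CARD('d)"
  have "expected_count M \<zeta> x \<le> ennreal (?d * C / (1 - ?\<rho>) * x powr - s)" if x: "0 < x" for x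
  proof -
    have "indicator {x..} y \<le> ennreal (x powr - s) * pos_powr s y" for y
    proof (cases "x \<le> y")
      case True
      have "1 \<le> x powr - s * y powr s"
        using x True s(2) by (simp add: powr_minus divide_simps powr_mono2)
      then show ?thesis using x True by (simp add: pos_powr_def flip: ennreal_mult)
    qed simp
    then have "level_expectation n j (indicator {x..}) \<le> ennreal (x powr - s) * level_expectation n j (pos_powr s)" for n j
      by (subst level_expectation_cmult[symmetric]) (auto intro!: level_expectation_mono)
    also have "\<dots> n j \<le> ennreal (x powr - s) * ennreal (C * ?\<rho> ^ n)" for n j
      by (intro mult_left_mono C) simp
    finally have bound: "level_expectation n j (indicator {x..}) \<le> ennreal (x powr - s * (C * ?\<rho> ^ n))" for n j
      using C \<rho> by (simp add: ennreal_mult)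
    have "expected_count M \<zeta> x \<le> (\<Sum>n. \<Sum>j\<in>(UNIV::'d set). ennreal (x powr - s * (C * ?\<rho> ^ n)))"
      unfolding expected_count_eq_levels by (intro suminf_le sum_mono bound) auto
    also have "\<dots> = (\<Sum>n. ennreal (?d * C * x powr - s * ?\<rho> ^ n))"
      using C \<rho> by (simp add: ennreal_of_nat_eq_real_of_nat mult_ac flip: ennreal_mult)
    also have "\<dots> = ennreal (\<Sum>n. ?d * C * x powr - s * ?\<rho> ^ n)"
      using C \<rho> less by (intro suminf_ennreal2 summable_mult summable_geometric) auto
    also have "(\<Sum>n. ?d * C * x powr - s * ?\<rho> ^ n) = ?d * C / (1 - ?\<rho>) * x powr - s"
      using \<rho> less by (subst suminf_mult) (auto simp: suminf_geometric summable_geometric)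
    finally show ?thesis .
  qed
  moreover have "0 \<le> ?d * C / (1 - ?\<rho>)" using C less by simp
  ultimately show thesis by (intro that)
qed

text \<open>Write \<open>y = exp (- t)\<close>.  For \<open>t \<le> b\<close> the exponent \<open>\<alpha>\<close> is traded for the larger exponent \<open>s\<close> at a bounded cost;
  for \<open>t > b\<close> the power is bounded by its value at the beginning of the slab of unit width that contains \<open>t\<close>.\<close>

lemma pos_powr_le_slabs:
  assumes "0 \<le> \<alpha>" "\<alpha> \<le> s"
  shows "pos_powr \<alpha> y \<le> ennreal (exp ((s - \<alpha>) * b)) * pos_powr s y
     + (\<Sum>k. ennreal (exp (- \<alpha> * (b + real k))) * indicator {exp (- (b + real k + 1))..} y)"
proof (cases "0 < y")
  case False then show ?thesis by (simp add: pos_powr_def)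
next
  case y: True
  define t where "t = - ln y"
  have yt: "y = exp (- t)" using y by (simp add: t_def)
  show ?thesis
  proof (cases "t \<le> b")
    case True
    have "(s - \<alpha>) * t \<le> (s - \<alpha>) * b" using True assms by (intro mult_left_mono) auto
    then have "y powr \<alpha> \<le> exp ((s - \<alpha>) * b) * y powr s"
      unfolding yt by (simp add: powr_def algebra_simps flip: exp_add)
    then have "pos_powr \<alpha> y \<le> ennreal (exp ((s - \<alpha>) * b)) * pos_powr s y"
      using y by (simp add: pos_powr_def flip: ennreal_mult)
    then show ?thesis by (rule order_trans) simp
  next
    case False
    define k where "k = nat \<lfloor>t - b\<rfloor>"
    have "real k = of_int \<lfloor>t - b\<rfloor>" using False by (simp add: k_def)
    then have k: "b + real k \<le> t" "t < b + real k + 1" by linarith+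
    define f :: "nat \<Rightarrow> ennreal" where
      "f k = ennreal (exp (- \<alpha> * (b + real k))) * indicator {exp (- (b + real k + 1))..} y" for k
    have "\<alpha> * (b + real k) \<le> \<alpha> * t" using k(1) assms(1) by (rule mult_left_mono)
    then have "pos_powr \<alpha> y \<le> f k" using k(2) y by (simp add: f_def pos_powr_def yt powr_def)
    also have "f k = (\<Sum>k\<in>{k}. f k)" by simp
    also have "\<dots> \<le> (\<Sum>k. f k)" by (rule sum_le_suminf) auto
    finally show ?thesis unfolding f_def by (rule order_trans) simp
  qed
qed

text \<open>Otherwise the slab decomposition at \<open>b = \<delta> * n\<close> bounds the \<open>\<alpha>\<close>-th moment of level \<open>n\<close> by \<open>C * q ^ n + D * p ^ n\<close>
  with \<open>p, q < 1\<close>, whereas it is bounded away from \<open>0\<close> because \<open>\<rho> \<alpha> = 1\<close>.\<close>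

lemma exists_large_level_tail:
  assumes \<alpha>: "\<alpha> \<in> moment_domain N \<xi>" "perron_root N \<xi> \<alpha> = 1"
    and s: "s \<in> moment_domain N \<xi>" "perron_root N \<xi> s < 1" "\<alpha> < s"
    and \<beta>: "0 < \<beta>" "\<beta> < \<alpha>"
  obtains n T where "0 < T" "ennreal (exp (\<beta> * T)) < level_expectation n r (indicator {exp (- T)..})"
proof (rule ccontr)
  assume not: "\<not> thesis"
  note witness = that
  have small: "level_expectation n r (indicator {exp (- T)..}) \<le> ennreal (exp (\<beta> * T))" if "0 < T" for n T
    using not witness[of T n] \<open>0 < T\<close> by (auto simp: not_less[symmetric])
  let ?\<rho> = "perron_root N \<xi> s"
  have \<rho>: "0 < ?\<rho>" by (rule perron_root_pos[OF s(1)])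
  \<comment> \<open>Half of the gain \<open>- ln (\<rho> s)\<close> per level pays for the change of exponent.\<close>
  define \<delta> where "\<delta> = - ln ?\<rho> / (2 * (s - \<alpha>))"
  have \<delta>: "0 < \<delta>" using s \<rho> by (simp add: \<delta>_def divide_neg_pos)
  define q where "q = exp ((s - \<alpha>) * \<delta>) * ?\<rho>"
  have half: "(s - \<alpha>) * \<delta> = - ln ?\<rho> / 2" using s by (simp add: \<delta>_def field_simps)
  have "q = exp ((s - \<alpha>) * \<delta>) * exp (ln ?\<rho>)" using \<rho> by (simp add: q_def)
  also have "\<dots> = exp (ln ?\<rho> / 2)" unfolding half by (simp flip: exp_add)
  finally have "q = exp (ln ?\<rho> / 2)" .
  then have q: "0 < q" "q < 1" using s(2) \<rho> by auto
  define e where "e = exp (- (\<alpha> - \<beta>))"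
  have e: "0 < e" "e < 1" using \<beta> by (auto simp: e_def)
  define p where "p = exp (- (\<alpha> - \<beta>) * \<delta>)"
  have p: "0 < p" "p < 1" using \<beta> \<delta> by (auto simp: p_def mult_neg_pos)
  obtain C where C: "0 \<le> C" "\<And>n j. level_expectation n j (pos_powr s) \<le> ennreal (C * ?\<rho> ^ n)"
    using level_moment_upper[OF s(1)] by metis
  obtain b where b: "0 < b" "\<And>n. ennreal (b * 1 ^ n) \<le> level_expectation (Suc n) r (pos_powr \<alpha>)"
    using level_moment_lower[OF \<alpha>(1)] \<alpha>(2) by metis
  define D where "D = exp \<beta> / (1 - e)"
  have upper: "level_expectation n r (pos_powr \<alpha>) \<le> ennreal (C * q ^ n + D * p ^ n)" for n
  proof -
    let ?b = "\<delta> * real n"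
    let ?slab = "\<lambda>k y. ennreal (exp (- \<alpha> * (?b + real k))) * indicator {exp (- (?b + real k + 1))..} y"
    have "level_expectation n r (pos_powr \<alpha>)
       \<le> level_expectation n r (\<lambda>y. ennreal (exp ((s - \<alpha>) * ?b)) * pos_powr s y + (\<Sum>k. ?slab k y))"
      using \<beta> s(3) by (intro level_expectation_mono pos_powr_le_slabs) auto
    also have "\<dots> = ennreal (exp ((s - \<alpha>) * ?b)) * level_expectation n r (pos_powr s)
        + (\<Sum>k. ennreal (exp (- \<alpha> * (?b + real k))) * level_expectation n r (indicator {exp (- (?b + real k + 1))..}))"
      by (subst level_expectation_add) (simp_all add: level_expectation_cmult level_expectation_suminf)
    also have "\<dots> \<le> ennreal (C * q ^ n) + ennreal (D * p ^ n)"
    proof (rule add_mono)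
      have "ennreal (exp ((s - \<alpha>) * ?b)) * level_expectation n r (pos_powr s)
          \<le> ennreal (exp ((s - \<alpha>) * ?b)) * ennreal (C * ?\<rho> ^ n)"
        by (intro mult_left_mono C) simp
      also have "\<dots> = ennreal (exp ((s - \<alpha>) * ?b) * (C * ?\<rho> ^ n))"
        using C \<rho> by (simp flip: ennreal_mult)
      also have "exp ((s - \<alpha>) * ?b) * (C * ?\<rho> ^ n) = C * q ^ n"
        by (simp add: q_def power_mult_distrib mult_ac flip: exp_of_nat_mult)
      finally show "ennreal (exp ((s - \<alpha>) * ?b)) * level_expectation n r (pos_powr s) \<le> ennreal (C * q ^ n)" .
    next
      have "(\<Sum>k. ennreal (exp (- \<alpha> * (?b + real k))) * level_expectation n r (indicator {exp (- (?b + real k + 1))..}))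
          \<le> (\<Sum>k. ennreal (exp (- \<alpha> * (?b + real k))) * ennreal (exp (\<beta> * (?b + real k + 1))))"
        using \<delta> by (intro suminf_le mult_left_mono small) (auto intro!: add_nonneg_pos)
      also have "\<dots> = (\<Sum>k. ennreal (exp \<beta> * p ^ n * e ^ k))"
        by (intro suminf_cong) (simp add: p_def e_def algebra_simps flip: ennreal_mult exp_of_nat_mult exp_add)
      also have "\<dots> = ennreal (\<Sum>k. exp \<beta> * p ^ n * e ^ k)"
        using p e by (intro suminf_ennreal2 summable_mult summable_geometric) auto
      also have "(\<Sum>k. exp \<beta> * p ^ n * e ^ k) = D * p ^ n"
        using e by (subst suminf_mult) (auto simp: suminf_geometric summable_geometric D_def)
      finally show "(\<Sum>k. ennreal (exp (- \<alpha> * (?b + real k))) * level_expectation n r (indicator {exp (- (?b + real k + 1))..}))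
         \<le> ennreal (D * p ^ n)" .
    qed
    also have "\<dots> = ennreal (C * q ^ n + D * p ^ n)"
      using C q p e by (simp add: D_def)
    finally show ?thesis .
  qed
  have "b \<le> C * q ^ Suc n + D * p ^ Suc n" for n
  proof -
    have "ennreal b \<le> ennreal (C * q ^ Suc n + D * p ^ Suc n)"
      using b(2)[of n] upper[of "Suc n"] by simp
    moreover have "0 \<le> C * q ^ Suc n + D * p ^ Suc n" using C q p e by (simp add: D_def)
    ultimately show ?thesis by (simp only: ennreal_le_iff)
  qed
  moreover have "(\<lambda>n. C * q ^ Suc n + D * p ^ Suc n) \<longlonglongrightarrow> C * 0 + D * 0"
    using q p by (intro tendsto_intros LIMSEQ_Suc LIMSEQ_power_zero) auto
  ultimately have "b \<le> C * 0 + D * 0" by (intro LIMSEQ_le_const) auto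
  with b(1) show False by simp
qed

text \<open>The excess at a single pair \<open>n, T\<close> is repeated \<open>k\<close> times, with \<open>k\<close> the integer part of \<open>t / T\<close>.\<close>

lemma expected_count_lower:
  assumes \<alpha>: "\<alpha> \<in> moment_domain N \<xi>" "perron_root N \<xi> \<alpha> = 1"
    and s: "s \<in> moment_domain N \<xi>" "perron_root N \<xi> s < 1" "\<alpha> < s"
    and \<beta>: "0 < \<beta>" "\<beta> < \<alpha>"
  obtains T where "\<And>t. 0 \<le> t \<Longrightarrow> ennreal (exp (\<beta> * (t - T))) \<le> expected_count M \<zeta> (exp (- t))"
proof -
  obtain n T where T: "0 < T" "ennreal (exp (\<beta> * T)) < level_expectation n r (indicator {exp (- T)..})"
    using exists_large_level_tail[OF assms] .
  have "ennreal (exp (\<beta> * (t - T))) \<le> expected_count M \<zeta> (exp (- t))" if t: "0 \<le> t" for t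
  proof -
    define k where "k = nat \<lfloor>t / T\<rfloor>"
    have "real k \<le> t / T" "t / T < real k + 1" using t T by (auto simp: k_def)
    then have k: "real k * T \<le> t" "t - T \<le> real k * T" using T by (auto simp: field_simps)
    have "exp (\<beta> * (t - T)) \<le> exp (\<beta> * T) ^ k"
      using k(2) \<beta> by (simp add: mult_left_mono mult.left_commute flip: exp_of_nat_mult)
    then have "ennreal (exp (\<beta> * (t - T))) \<le> ennreal (exp (\<beta> * T)) ^ k"
      by (simp add: ennreal_leI ennreal_power)
    also have "\<dots> \<le> level_expectation n r (indicator {exp (- T)..}) ^ k"
      using T(2) by (intro power_mono) auto
    also have "\<dots> \<le> level_expectation (k * n) r (indicator {exp (- T) ^ k..})"
      by (rule level_tail_power) simp
    also have "\<dots> \<le> level_expectation (k * n) r (indicator {exp (- t)..})"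
    proof (rule level_expectation_mono)
      have "exp (- t) \<le> exp (- T) ^ k" using k(1) by (simp flip: exp_of_nat_mult)
      then show "indicator {exp (- T) ^ k..} y \<le> (indicator {exp (- t)..} y :: ennreal)" for y
        by (auto simp: indicator_def)
    qed
    also have "\<dots> \<le> (\<Sum>j\<in>UNIV. level_expectation (k * n) j (indicator {exp (- t)..}))"
      by (rule member_le_sum) auto
    also have "\<dots> = (\<Sum>n\<in>{k * n}. \<Sum>j\<in>UNIV. level_expectation n j (indicator {exp (- t)..}))" by simp
    also have "\<dots> \<le> expected_count M \<zeta> (exp (- t))"
      unfolding expected_count_eq_levels by (rule sum_le_suminf) auto
    finally show ?thesis .
  qed
  then show thesis by (rule that)
qed

section \<open>The critical exponent\<close>

lemma perron_root_less_1_between: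
  assumes dom: "a \<in> moment_domain N \<xi>" "b \<in> moment_domain N \<xi>" "x \<in> moment_domain N \<xi>"
    and x: "a < x" "x \<le> b" and "perron_root N \<xi> a \<le> 1" "perron_root N \<xi> b < 1"
  shows "perron_root N \<xi> x < 1"
proof -
  define \<theta> where "\<theta> = (x - a) / (b - a)"
  have \<theta>: "0 < \<theta>" "\<theta> \<le> 1" using x by (auto simp: \<theta>_def)
  have "\<theta> * (b - a) = x - a" using x by (simp add: \<theta>_def)
  then have x_eq: "(1-\<theta>) * a + \<theta> * b = x" by (simp add: algebra_simps)
  have "perron_root N \<xi> x \<le> perron_root N \<xi> a powr (1-\<theta>) * perron_root N \<xi> b powr \<theta>"
    using perron_root_log_convex[OF dom(1,2), of \<theta>] \<theta> dom(3) by (simp add: x_eq)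
  also have "\<dots> \<le> 1 * perron_root N \<xi> b powr \<theta>"
    using assms(6) \<theta> perron_root_pos[OF dom(1)] powr_mono2[of "1-\<theta>" "perron_root N \<xi> a" 1]
    by (intro mult_right_mono) auto
  also have "\<dots> < 1"
    using assms(7) \<theta> perron_root_pos[OF dom(2)] powr_less_mono2[of \<theta> "perron_root N \<xi> b" 1] by simp
  finally show ?thesis .
qed

text \<open>The function \<open>ln \<circ> \<rho>\<close> is convex on an open interval that contains the half-line, hence
  continuous there up to and including \<open>0\<close>; it is positive at \<open>0\<close> and negative at \<open>s\<close>.  A zero to the left of \<open>\<alpha>\<close>, be it
  negative, would by convexity force \<open>\<rho> \<alpha> < 1\<close>.\<close>

lemma critical_exponent:
  assumes half_line: "{0..} \<subseteq> moment_domain N \<xi>" and interior: "0 \<in> interior (moment_domain N \<xi>)"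
    and d: "2 \<le> CARD('d)" and s: "0 \<le> s" "perron_root N \<xi> s < 1"
  obtains \<alpha> where "0 < \<alpha>" "\<alpha> < s" "perron_root N \<xi> \<alpha> = 1"
    "\<And>x. x \<in> moment_domain N \<xi> \<Longrightarrow> perron_root N \<xi> x = 1 \<Longrightarrow> \<alpha> \<le> x"
    "\<And>x. \<alpha> < x \<Longrightarrow> x \<le> s \<Longrightarrow> perron_root N \<xi> x < 1"
proof -
  let ?D = "moment_domain N \<xi>" and ?f = "\<lambda>x. ln (perron_root N \<xi> x)"
  obtain e where e: "0 < e" "ball 0 e \<subseteq> ?D" using interior by (auto simp: mem_interior)
  have sub: "{- e<..} \<subseteq> ?D"
  proof
    fix x assume x: "x \<in> {- e<..}"
    show "x \<in> ?D"
    proof (cases "0 \<le> x")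
      case True then show ?thesis using half_line by auto
    next
      case False then have "x \<in> ball 0 e" using x by (simp add: dist_real_def)
      then show ?thesis using e(2) by blast
    qed
  qed
  \<comment> \<open>Openness to the left of \<open>0\<close> gives continuity at \<open>0\<close>, where the intermediate value theorem starts.\<close>
  have "convex_on {- e<..} ?f"
  proof (rule convex_onI)
    fix t x y :: real assume t: "0 < t" "t < 1" and xy: "x \<in> {- e<..}" "y \<in> {- e<..}"
    have "(1 - t) * x + t * y \<in> {- e<..}"
      using convexD[OF convex_real_interval(3), of x "- e" y "1 - t" t] t xy by simp
    then have dom: "x \<in> ?D" "y \<in> ?D" "(1 - t) * x + t * y \<in> ?D" using xy sub by auto
    note pos = dom[THEN perron_root_pos]
    have "?f ((1 - t) * x + t * y) \<le> ln (perron_root N \<xi> x powr (1-t) * perron_root N \<xi> y powr t)"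
      using perron_root_log_convex[OF dom(1,2) _ _ dom(3)] t pos by (intro ln_mono) auto
    also have "\<dots> = (1 - t) * ?f x + t * ?f y"
      using pos by (simp add: ln_mult ln_powr)
    finally show "?f ((1 - t) *\<^sub>R x + t *\<^sub>R y) \<le> (1 - t) * ?f x + t * ?f y" by simp
  qed (rule convex_real_interval)
  then have "continuous_on {- e<..} ?f" by (intro convex_on_continuous) auto
  then have cont: "continuous_on {0..s} ?f" by (rule continuous_on_subset) (use e in auto)
  have f0: "0 < ?f 0" using d by (simp add: perron_root_0)
  have fs: "?f s < 0" using s half_line perron_root_pos[of s] by auto
  obtain \<alpha> where \<alpha>: "0 \<le> \<alpha>" "\<alpha> \<le> s" "?f \<alpha> = 0"
    using IVT2'[of ?f s 0 0, OF _ _ s(1) cont] f0 fs by auto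
  have D: "\<alpha> \<in> ?D" "s \<in> ?D" using \<alpha> s half_line by auto
  have root: "perron_root N \<xi> \<alpha> = 1" using \<alpha>(3) perron_root_pos[OF D(1)] by simp
  have "\<alpha> \<noteq> 0" "\<alpha> \<noteq> s" using \<alpha>(3) f0 fs by auto
  show thesis
  proof (rule that)
    show "0 < \<alpha>" "\<alpha> < s" "perron_root N \<xi> \<alpha> = 1"
      using \<alpha> root \<open>\<alpha> \<noteq> 0\<close> \<open>\<alpha> \<noteq> s\<close> by auto
    show "\<alpha> \<le> x" if "x \<in> ?D" "perron_root N \<xi> x = 1" for x
    proof (rule ccontr)
      assume "\<not> \<alpha> \<le> x"
      then have "perron_root N \<xi> \<alpha> < 1"
        using perron_root_less_1_between[of x s \<alpha>] that D \<alpha>(2) s by simp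
      with root show False by simp
    qed
    show "perron_root N \<xi> x < 1" if "\<alpha> < x" "x \<le> s" for x
    proof -
      have "x \<in> ?D" using that \<alpha>(1) half_line by auto
      then show ?thesis using perron_root_less_1_between[of \<alpha> s x] that D s root by simp
    qed
  qed
qed

end

theorem corollary1:
  fixes N :: "'b measure" and \<xi> :: "'d::finite \<Rightarrow> 'd \<Rightarrow> 'b \<Rightarrow> real"
    and M :: "'a measure" and r :: 'd
    and c :: "'d list \<Rightarrow> 'a \<Rightarrow> 'd" and \<zeta> :: "'d list \<Rightarrow> 'a \<Rightarrow> real"
    and \<mu> :: real
  assumes d_ge_2: "CARD('d) \<ge> 2"
    and model: "coloured_tree N \<xi> M r c \<zeta>"
    and i: "{0..1} \<subseteq> moment_domain N \<xi>" "0 \<in> interior (moment_domain N \<xi>)"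
    and ii: "\<And>i j. integrable N (\<lambda>x. \<bar>ln (\<xi> i j x)\<bar>)"
      "\<And>i j. integrable N (\<lambda>x. \<bar>\<xi> i j x * ln (\<xi> i j x)\<bar>)"
    \<comment> \<open>Being of class \<open>C\<^sup>2\<close> on the half-line includes being finite there.\<close>
    and iii: "{0..} \<subseteq> moment_domain N \<xi>"
      "\<And>i j. C2_on {0..} (\<lambda>s. integral\<^sup>L N (\<lambda>x. \<xi> i j x powr s))"
    and lambda: "(INF s\<in>{0..}. perron_root N \<xi> s) < 1"
    and mu: "(log_perron N \<xi> has_real_derivative - \<mu>) (at 0)" "\<mu> > 0"
  shows "(\<forall>x>0. expected_count M \<zeta> x < \<infinity>) \<and>
    (\<exists>\<alpha>. (\<alpha> \<in> moment_domain N \<xi> \<and> perron_root N \<xi> \<alpha> = 1 \<and>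
          (\<forall>s\<in>moment_domain N \<xi>. perron_root N \<xi> s = 1 \<longrightarrow> \<alpha> \<le> s)) \<and>
         ((\<lambda>t. ln (enn2real (expected_count M \<zeta> (exp (- t)))) / t) \<longlongrightarrow> \<alpha>) at_top)"
proof -
  interpret coloured_tree N \<xi> M r c \<zeta> by (rule model)
  obtain s where s: "0 \<le> s" "perron_root N \<xi> s < 1"
    using cInf_lessD[OF _ lambda] by auto
  obtain \<alpha> where \<alpha>: "0 < \<alpha>" "\<alpha> < s" "perron_root N \<xi> \<alpha> = 1"
    and least: "\<And>x. x \<in> moment_domain N \<xi> \<Longrightarrow> perron_root N \<xi> x = 1 \<Longrightarrow> \<alpha> \<le> x"
    and below: "\<And>x. \<alpha> < x \<Longrightarrow> x \<le> s \<Longrightarrow> perron_root N \<xi> x < 1"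
    using critical_exponent[OF iii(1) i(2) d_ge_2 s] by metis
  have D: "x \<in> moment_domain N \<xi>" if "0 \<le> x" for x using iii(1) that by auto
  have finite: "expected_count M \<zeta> x < \<infinity>" if "0 < x" for x
  proof -
    obtain C where "\<And>x. 0 < x \<Longrightarrow> expected_count M \<zeta> x \<le> ennreal (C * x powr - s)"
      using expected_count_upper[OF D s] s(1) by metis
    from this[OF that] show ?thesis by (auto simp: le_less_trans)
  qed
  define h where "h t = enn2real (expected_count M \<zeta> (exp (- t)))" for t
  have h: "expected_count M \<zeta> (exp (- t)) = ennreal (h t)" "0 \<le> h t" for t
    using finite[of "exp (- t)"] by (auto simp: h_def)
  have lower: "\<exists>T. \<forall>t\<ge>0. exp (\<beta> * (t - T)) \<le> h t" if "0 < \<beta>" "\<beta> < \<alpha>" for \<beta>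
  proof -
    obtain T where "\<And>t. 0 \<le> t \<Longrightarrow> ennreal (exp (\<beta> * (t - T))) \<le> expected_count M \<zeta> (exp (- t))"
      using expected_count_lower[OF D[of \<alpha>] \<alpha>(3) D[OF s(1)] s(2) \<alpha>(2) \<open>0 < \<beta>\<close> \<open>\<beta> < \<alpha>\<close>] \<alpha>(1) by auto
    then show ?thesis using h by (metis ennreal_le_iff)
  qed
  obtain T0 where "\<And>t. 0 \<le> t \<Longrightarrow> exp (\<alpha> / 2 * (t - T0)) \<le> h t"
    using lower[of "\<alpha> / 2"] \<alpha>(1) by auto
  then have h_pos: "0 < h t" if "0 \<le> t" for t
    using that by (meson exp_gt_zero less_le_trans)
  have "((\<lambda>t. ln (h t) / t) \<longlongrightarrow> \<alpha>) at_top"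
  proof (rule order_tendstoI)
    fix a assume "a < \<alpha>"
    \<comment> \<open>Some positive rate strictly between \<open>a\<close> and \<open>\<alpha>\<close>.\<close>
    define \<beta> where "\<beta> = (max a 0 + \<alpha>) / 2"
    have \<beta>: "0 < \<beta>" "\<beta> < \<alpha>" "a < \<beta>" using \<open>a < \<alpha>\<close> \<alpha>(1) by (auto simp: \<beta>_def max_def)
    obtain T where T: "\<And>t. 0 \<le> t \<Longrightarrow> exp (\<beta> * (t - T)) \<le> h t" using lower[OF \<beta>(1,2)] by auto
    have "((\<lambda>t. \<beta> - \<beta> * T / t) \<longlongrightarrow> \<beta>) at_top" by real_asymp
    then have "\<forall>\<^sub>F t in at_top. a < \<beta> - \<beta> * T / t" using \<beta>(3) by (rule order_tendstoD)
    with eventually_gt_at_top[of 0] show "\<forall>\<^sub>F t in at_top. a < ln (h t) / t"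
    proof eventually_elim
      case (elim t)
      have "\<beta> * (t - T) \<le> ln (h t)" using T[of t] h_pos[of t] elim by (simp add: ln_ge_iff)
      then have "\<beta> * (t - T) / t \<le> ln (h t) / t" using elim by (intro divide_right_mono) auto
      then have "\<beta> - \<beta> * T / t \<le> ln (h t) / t"
        using elim by (simp add: right_diff_distrib diff_divide_distrib)
      with elim show ?case by linarith
    qed
  next
    fix a assume "\<alpha> < a"
    define \<sigma> where "\<sigma> = min ((\<alpha> + a) / 2) s"
    have \<sigma>: "\<alpha> < \<sigma>" "\<sigma> \<le> s" "\<sigma> < a" using \<open>\<alpha> < a\<close> \<alpha>(2) by (auto simp: \<sigma>_def min_def)
    have \<sigma>0: "0 \<le> \<sigma>" using \<sigma> \<alpha> by simp
    obtain C where C: "0 \<le> C" "\<And>x. 0 < x \<Longrightarrow> expected_count M \<zeta> x \<le> ennreal (C * x powr - \<sigma>)"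
      using expected_count_upper[OF D[OF \<sigma>0] \<sigma>0 below[OF \<sigma>(1,2)]] by metis
    have "((\<lambda>t. ln (C + 1) / t + \<sigma>) \<longlongrightarrow> \<sigma>) at_top" by real_asymp
    then have "\<forall>\<^sub>F t in at_top. ln (C + 1) / t + \<sigma> < a" using \<sigma>(3) by (rule order_tendstoD)
    with eventually_gt_at_top[of 0] show "\<forall>\<^sub>F t in at_top. ln (h t) / t < a"
    proof eventually_elim
      case (elim t)
      have "h t \<le> C * exp (- t) powr - \<sigma>" using C(2)[of "exp (- t)"] C(1) by (simp add: h)
      also have "\<dots> = C * exp (\<sigma> * t)" by (simp add: powr_def)
      also have "\<dots> \<le> (C + 1) * exp (\<sigma> * t)" by (simp add: mult_right_mono)
      finally have "ln (h t) \<le> ln ((C + 1) * exp (\<sigma> * t))" using h_pos[of t] elim by (intro ln_mono) auto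
      also have "\<dots> = ln (C + 1) + \<sigma> * t" using C(1) by (simp add: ln_mult)
      finally have "ln (h t) / t \<le> ln (C + 1) / t + \<sigma>" using elim by (simp add: field_simps)
      with elim show ?case by linarith
    qed
  qed
  then show ?thesis
    using finite D[of \<alpha>] \<alpha> least unfolding h_def by auto
qed

end
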